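(* Let $(\mathfrak V,\mathfrak V^+,|\cdot|)$ be a non-degenerate absolutely ordered $\mathfrak F$-bimodule. Let $(V,\{M_n(V)^+\})$ be the matrix ordered space whose matricial inductive limit is $(\mathfrak V,\mathfrak V^+)$, that is, $V=\mathfrak I_1\mathfrak V\mathfrak I_1$, $T_n:M_n(V)\to\mathfrak V$ is $T_n([v_{i,j}])=\sum_{i,j=1}^n\mathfrak e_{i,1}v_{i,j}\mathfrak e_{1,j}$, and $M_n(V)^+=T_n^{-1}(\mathfrak I_n\mathfrak V^+\mathfrak I_n)$. For $n\in\mathbb N$ and $v\in M_n(V)$ define $|v|_n:=T_n^{-1}(|T_n(v)|)$, and consider the map $|\cdot|_n:M_n(V)\to M_n(V)^+$. Then $(V,\{M_n(V)^+\},\{|\cdot|_n\})$ is an absolutely matrix ordered space, and $(\mathfrak V,\mathfrak V^+,|\cdot|)$ is its matricial inductive limit (i.e. moreover $|\mathfrak v|=T_{o(\mathfrak v)}(|T_{o(\mathfrak v)}^{-1}(\mathfrak v)|_{o(\mathfrak v)})$ for all $\mathfrak v\in\mathfrak V$).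
   Context: **Bimodules.** $\mathfrak F$ is the $*$-algebra of all $\infty\times\infty$ complex matrices with at most finitely many non-zero entries, with conjugate transpose $*$ and operator norm $\|\cdot\|$; $\mathfrak e_{i,j}$ are its matrix units, $\mathfrak I_n=\sum_{i=1}^n\mathfrak e_{i,i}$ and $\mathfrak J_n=\sum_{i=1}^n\mathfrak e_{i,n+i}$. An $\mathfrak F$-bimodule $\mathfrak V$ is non-degenerate if for every $\mathfrak v\in\mathfrak V$ there is $n$ with $\mathfrak I_n\mathfrak v\mathfrak I_n=\mathfrak v$; the least such $n\in\mathbb N$ is the order $o(\mathfrak v)$. It is a complex vector space via $\alpha\mathfrak v=(\alpha\mathfrak I_n)\mathfrak v$ for any such $n$. A $*$-$\mathfrak F$-bimodule has an additive map $*$ with $(\mathfrak a\mathfrak v)^*=\mathfrak v^*\mathfrak a^*$, $(\mathfrak v\mathfrak a)^*=\mathfrak a^*\mathfrak v^*$, $\mathfrak v^{**}=\mathfrak v$; $\mathfrak V_{sa}=\{\mathfrak v:\mathfrak v^*=\mathfrak v\}$. An ordered $\mathfrak F$-bimodule $(\mathfrak V,\mathfrak V^+)$ is a $*$-$\mathfrak F$-bimodule with $\mathfrak V^+\subset\mathfrak V_{sa}$ closed under addition and under $\mathfrak v\mapsto\mathfrak a^*\mathfrak v\mathfrak a$ ($\mathfrak a\in\mathfrak F$); $\mathfrak u\le\mathfrak v$ means $\mathfrak v-\mathfrak u\in\mathfrak V^+$. For $\mathfrak v_1,\mathfrak v_2\in\mathfrak V^+$ and $\mathfrak v\in\mathfrak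 V$, all fixed by $\mathfrak x\mapsto\mathfrak I_n\mathfrak x\mathfrak I_n$, put $(\mathfrak v_1,\mathfrak v_2)_n^+=\mathfrak v_1+\mathfrak J_n^*\mathfrak v_2\mathfrak J_n$ and $sa_n(\mathfrak v)=\mathfrak I_n\mathfrak v\mathfrak J_n+\mathfrak J_n^*\mathfrak v^*\mathfrak I_n$. Elements $\mathfrak u,\mathfrak v\in\mathfrak V$ are $\mathfrak F$-independent if there are disjoint (finite) $I,J\subset\mathbb N$ with $\mathfrak r\mathfrak u\mathfrak r=\mathfrak u$, $\mathfrak s\mathfrak v\mathfrak s=\mathfrak v$, where $\mathfrak r=\sum_{i\in I}\mathfrak e_{i,i}$, $\mathfrak s=\sum_{j\in J}\mathfrak e_{j,j}$. A *non-degenerate absolutely ordered $\mathfrak F$-bimodule* $(\mathfrak V,\mathfrak V^+,|\cdot|)$ is a non-degenerate ordered $\mathfrak F$-bimodule with a map $|\cdot|:\mathfrak V\to\mathfrak V^+$ such that: (1) $o(|\mathfrak v|)\le o(\mathfrak v)$; (2) $|\mathfrak v|=\mathfrak v$ for $\mathfrak v\in\mathfrak V^+$; (3) $(|\mathfrak v^*|,|\mathfrak v|)^+_{o(\mathfrak v)}+sa_{o(\mathfrak v)}(\mathfrak v)\in\mathfrak V^+$ for all $\mathfrak v$; (4) $|\mathfrak a\mathfrak v\mathfrak b|\le\|\mathfrak a\|\,\big||\mathfrak v|\mathfrak b\big|$ for $\mathfrak v\in\mathfrak V$, $\mathfrak a,\mathfrak b\in\mathfrak F$; (5) $|\mathfrak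 u+\mathfrak v|=|\mathfrak u|+|\mathfrak v|$ for $\mathfrak F$-independent $\mathfrak u,\mathfrak v$; (6) for $\mathfrak u,\mathfrak v,\mathfrak w\in\mathfrak V^+$ with $|\mathfrak u-\mathfrak v|=\mathfrak u+\mathfrak v$ and $0\le\mathfrak w\le\mathfrak v$: $|\mathfrak u-\mathfrak w|=\mathfrak u+\mathfrak w$; (7) for $\mathfrak u,\mathfrak v,\mathfrak w\in\mathfrak V^+$ with $|\mathfrak u-\mathfrak v|=\mathfrak u+\mathfrak v$ and $|\mathfrak u-\mathfrak w|=\mathfrak u+\mathfrak w$: $\big|\mathfrak u-|\mathfrak v\pm\mathfrak w|\big|=\mathfrak u+|\mathfrak v\pm\mathfrak w|$. **Matrix ordered spaces.** $M_{m,n}(V)$ denotes $m\times n$ matrices over $V$, $M_{m,n}=M_{m,n}(\mathbb C)$, $v\oplus w$ is the block diagonal matrix. A matrix ordered space is a complex vector space $V$ with involution (with $[v_{ij}]^*=[v_{ji}^*]$ on matrices) and cones $M_n(V)^+\subset M_n(V)_{sa}$ such that each $(M_n(V)_{sa},M_n(V)^+)$ is a real ordered vector space and $a^*va\in M_m(V)^+$ for $v\in M_n(V)^+$, $a\in M_{n,m}$. For $V=\mathfrak I_1\mathfrak V\mathfrak I_1$ as in the claim it is known that $T_n$ is an injective linear map onto $\mathfrak I_n\mathfrak V\mathfrak I_n$, that $(V,\{M_n(V)^+\})$ is a matrix ordered space, and that $\mathfrak V=\bigcup_nT_n(M_n(V))$, $\mathfrak V^+=\bigcup_nT_n(M_n(V)^+)$,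 with $T_{n+m}(v\oplus0_m)=T_n(v)$. An absolutely ordered space $(X,X^+,|\cdot|)$ is a real ordered vector space with $|\cdot|:X\to X^+$ such that: $|v|=v$ for $v\in X^+$; $|v|\pm v\in X^+$; $|kv|=|k||v|$ for $k\in\mathbb R$; if $|u-v|=u+v$ and $0\le w\le v$ then $|u-w|=u+w$; if $|u-v|=u+v$ and $|u-w|=u+w$ then $\big|u-|v\pm w|\big|=u+|v\pm w|$. An absolutely matrix ordered space is a matrix ordered space with maps $|\cdot|_{m,n}:M_{m,n}(V)\to M_n(V)^+$ ($|\cdot|_n:=|\cdot|_{n,n}$) such that: (1) each $(M_n(V)_{sa},M_n(V)^+,|\cdot|_n)$ is an absolutely ordered space; (2) $|\alpha v\beta|_{r,s}\le\|\alpha\|\,\big||v|_{m,n}\beta\big|_{n,s}$ for $v\in M_{m,n}(V)$, $\alpha\in M_{r,m}$, $\beta\in M_{n,s}$; (3) $|v\oplus w|_{m+r,n+s}=|v|_{m,n}\oplus|w|_{r,s}$. Saying that $(V,\{M_n(V)^+\},\{|\cdot|_n\})$, with only the square maps displayed, is an absolutely matrix ordered space means that there are maps $|\cdot|_{m,n}$ with $|\cdot|_{n,n}=|\cdot|_n$ satisfying (1)–(3). These are forced: $|v|_{m,n}=\left|\begin{bmatrix}v\\0\end{bmatrix}\right|_n$ for $m\le n$, and $|v|_{m,n}\oplus0_{m-n}=\left|\begin{bmatrix}v&0\end{bmatrix}\right|_m$ for $m>n$. *)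

theory Defs
  imports "Jordan_Normal_Form.Matrix" "HOL-Analysis.L2_Norm"
begin

section \<open>The algebra of finitely supported infinite matrices\<close>

text \<open>All index sets are 0-based, as in the matrix library: the matrix unit usually written
  with indices \<open>i, j \<ge> 1\<close> is \<open>munit (i - 1) (j - 1)\<close> here. Sizes of matrices and orders of
  elements, on the other hand, always range over the positive integers.\<close>

typedef fin_mat = "{f :: nat \<Rightarrow> nat \<Rightarrow> complex. finite {(i, j). f i j \<noteq> 0}}"
  morphisms entry Abs_fin_mat
  by (rule exI[of _ "\<lambda>_ _. 0"]) simp

lemma finite_entry: "finite {(i, j). entry a i j \<noteq> 0}"
  using entry[of a] by simp

lemma fin_mat_eqI: "(\<And>i j. entry a i j = entry b i j) \<Longrightarrow> a = b"
  by (simp add: entry_inject[symmetric] fun_eq_iff)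

lemma entry_Abs:
  assumes "finite S" "\<And>i j. f i j \<noteq> 0 \<Longrightarrow> (i, j) \<in> S"
  shows "entry (Abs_fin_mat f) = f"
proof -
  have "{(i, j). f i j \<noteq> 0} \<subseteq> S" using assms(2) by auto
  then show ?thesis using assms(1) by (simp add: Abs_fin_mat_inverse finite_subset)
qed

lemma finite_row: "finite {j. entry a i j \<noteq> 0}"
proof (rule finite_subset)
  show "{j. entry a i j \<noteq> 0} \<subseteq> snd ` {(i, j). entry a i j \<noteq> 0}" by force
qed (simp add: finite_entry)

instantiation fin_mat :: ring
begin

definition "0 = Abs_fin_mat (\<lambda>_ _. 0)"
definition "a + b = Abs_fin_mat (\<lambda>i j. entry a i j + entry b i j)"
definition "- a = Abs_fin_mat (\<lambda>i j. - entry a i j)"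
definition "a - b = Abs_fin_mat (\<lambda>i j. entry a i j - entry b i j)"
definition "a * b = Abs_fin_mat (\<lambda>i k. \<Sum>j | entry a i j \<noteq> 0. entry a i j * entry b j k)"

lemma entry_zero [simp]: "entry 0 i j = 0"
  unfolding zero_fin_mat_def by (subst entry_Abs[of "{}"]) auto

lemma entry_plus [simp]: "entry (a + b) i j = entry a i j + entry b i j"
  unfolding plus_fin_mat_def
  by (subst entry_Abs[of "{(i, j). entry a i j \<noteq> 0} \<union> {(i, j). entry b i j \<noteq> 0}"])
     (auto simp: finite_entry)

lemma entry_uminus [simp]: "entry (- a) i j = - entry a i j"
  unfolding uminus_fin_mat_def
  by (subst entry_Abs[of "{(i, j). entry a i j \<noteq> 0}"]) (auto simp: finite_entry)

lemma entry_minus [simp]: "entry (a - b) i j = entry a i j - entry b i j"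
  unfolding minus_fin_mat_def
  by (subst entry_Abs[of "{(i, j). entry a i j \<noteq> 0} \<union> {(i, j). entry b i j \<noteq> 0}"])
     (auto simp: finite_entry)

lemma entry_times: "entry (a * b) i k = (\<Sum>j | entry a i j \<noteq> 0. entry a i j * entry b j k)"
  unfolding times_fin_mat_def
proof (subst entry_Abs[of "fst ` {(i, j). entry a i j \<noteq> 0} \<times> snd ` {(i, j). entry b i j \<noteq> 0}"])
  fix i k assume "(\<Sum>j | entry a i j \<noteq> 0. entry a i j * entry b j k) \<noteq> 0"
  then obtain j where "entry a i j * entry b j k \<noteq> 0"
    by (meson sum.neutral)
  then show "(i, k) \<in> fst ` {(i, j). entry a i j \<noteq> 0} \<times> snd ` {(i, j). entry b i j \<noteq> 0}"
    by force
qed (auto simp: finite_entry)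

lemma entry_times_superset:
  assumes "finite S" "{j. entry a i j \<noteq> 0} \<subseteq> S"
  shows "entry (a * b) i k = (\<Sum>j\<in>S. entry a i j * entry b j k)"
  unfolding entry_times using assms by (intro sum.mono_neutral_left) auto

instance
proof
  fix a b c :: fin_mat
  show "a * b * c = a * (b * c)"
  proof (rule fin_mat_eqI)
    fix i l
    let ?A = "{j. entry a i j \<noteq> 0}"
    let ?B = "\<Union>j\<in>?A. {k. entry b j k \<noteq> 0}"
    have fin: "finite ?A" "finite ?B" by (auto simp: finite_row)
    have sub: "{k. entry (a * b) i k \<noteq> 0} \<subseteq> ?B"
    proof
      fix k assume "k \<in> {k. entry (a * b) i k \<noteq> 0}"
      then have "(\<Sum>j\<in>?A. entry a i j * entry b j k) \<noteq> 0" by (simp add: entry_times)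
      then obtain j where "j \<in> ?A" "entry a i j * entry b j k \<noteq> 0" by (meson sum.neutral)
      then show "k \<in> ?B" by auto
    qed
    have "entry (a * b * c) i l = (\<Sum>k\<in>?B. \<Sum>j\<in>?A. entry a i j * entry b j k * entry c k l)"
      by (subst entry_times_superset[OF fin(2) sub]) (simp add: entry_times sum_distrib_right)
    also have "\<dots> = (\<Sum>j\<in>?A. entry a i j * (\<Sum>k\<in>?B. entry b j k * entry c k l))"
      by (subst sum.swap) (simp add: sum_distrib_left mult.assoc)
    also have "\<dots> = (\<Sum>j\<in>?A. entry a i j * entry (b * c) j l)"
      by (intro sum.cong refl) (subst entry_times_superset[OF fin(2)], auto)
    also have "\<dots> = entry (a * (b * c)) i l" by (simp add: entry_times)
    finally show "entry (a * b * c) i l = entry (a * (b * c)) i l" .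
  qed
  show "(a + b) * c = a * c + b * c"
  proof (rule fin_mat_eqI)
    fix i k
    let ?S = "{j. entry a i j \<noteq> 0} \<union> {j. entry b i j \<noteq> 0}"
    have "finite ?S" by (simp add: finite_row)
    then show "entry ((a + b) * c) i k = entry (a * c + b * c) i k"
      by (subst entry_plus, subst (1 2 3) entry_times_superset[of ?S])
         (auto simp: sum.distrib algebra_simps)
  qed
  show "a * (b + c) = a * b + a * c"
    by (rule fin_mat_eqI) (simp add: entry_times sum.distrib algebra_simps)
qed (auto intro!: fin_mat_eqI)

end

definition fin_scale :: "complex \<Rightarrow> fin_mat \<Rightarrow> fin_mat" where
  "fin_scale \<alpha> a = Abs_fin_mat (\<lambda>i j. \<alpha> * entry a i j)"

definition fin_adj :: "fin_mat \<Rightarrow> fin_mat" where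
  "fin_adj a = Abs_fin_mat (\<lambda>i j. cnj (entry a j i))"

definition munit :: "nat \<Rightarrow> nat \<Rightarrow> fin_mat" where
  "munit i j = Abs_fin_mat (\<lambda>k l. if k = i \<and> l = j then 1 else 0)"

lemma entry_fin_scale [simp]: "entry (fin_scale \<alpha> a) i j = \<alpha> * entry a i j"
  unfolding fin_scale_def
  by (subst entry_Abs[of "{(i, j). entry a i j \<noteq> 0}"]) (auto simp: finite_entry)

lemma entry_fin_adj [simp]: "entry (fin_adj a) i j = cnj (entry a j i)"
  unfolding fin_adj_def
proof (subst entry_Abs[of "prod.swap ` {(i, j). entry a i j \<noteq> 0}"])
  fix i j assume "cnj (entry a j i) \<noteq> 0"
  then have "(j, i) \<in> {(i, j). entry a i j \<noteq> 0}" by simp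
  then show "(i, j) \<in> prod.swap ` {(i, j). entry a i j \<noteq> 0}" by force
qed (simp_all add: finite_entry)

lemma entry_munit [simp]: "entry (munit i j) k l = (if k = i \<and> l = j then 1 else 0)"
  unfolding munit_def by (subst entry_Abs[of "{(i, j)}"]) (auto split: if_splits)

definition Iunit :: "nat \<Rightarrow> fin_mat" where
  "Iunit n = (\<Sum>i<n. munit i i)"

definition Junit :: "nat \<Rightarrow> fin_mat" where
  "Junit n = (\<Sum>i<n. munit i (n + i))"

text \<open>The operator norm: a finitely supported matrix acts on finitely supported sequences with
  the Euclidean norm.\<close>

definition seq_norm :: "(nat \<Rightarrow> complex) \<Rightarrow> real" where
  "seq_norm x = L2_set (\<lambda>i. cmod (x i)) {i. x i \<noteq> 0}"

definition fin_norm :: "fin_mat \<Rightarrow> real" where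
  "fin_norm a = (SUP x \<in> {x. finite {j. x j \<noteq> 0} \<and> seq_norm x \<le> 1}.
     seq_norm (\<lambda>i. \<Sum>j | x j \<noteq> 0. entry a i j * x j))"


section \<open>Absolutely ordered bimodules over this algebra\<close>

locale F_actions =
  fixes lact :: "fin_mat \<Rightarrow> 'v::ab_group_add \<Rightarrow> 'v" (infixr \<open>\<rhd>\<close> 75)
    and ract :: "'v \<Rightarrow> fin_mat \<Rightarrow> 'v" (infixl \<open>\<lhd>\<close> 74)
begin

definition supported :: "nat \<Rightarrow> 'v \<Rightarrow> bool" where
  "supported n v \<longleftrightarrow> Iunit n \<rhd> v \<lhd> Iunit n = v"

definition ord :: "'v \<Rightarrow> nat" where
  "ord v = (LEAST n. 1 \<le> n \<and> supported n v)"

text \<open>For a non-degenerate bimodule \<open>(\<alpha> I\<^sub>n) v\<close> is the same for all \<open>n\<close> such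
  that \<open>v\<close> is \<open>supported\<close> at \<open>n\<close> (lemma \<open>cscale_eq\<close> below); the least one is chosen.\<close>

definition cscale :: "complex \<Rightarrow> 'v \<Rightarrow> 'v" where
  "cscale \<alpha> v = fin_scale \<alpha> (Iunit (ord v)) \<rhd> v"

definition corner :: "nat \<Rightarrow> 'v set" where
  "corner n = range (\<lambda>v. Iunit n \<rhd> v \<lhd> Iunit n)"

definition pair :: "nat \<Rightarrow> 'v \<Rightarrow> 'v \<Rightarrow> 'v" where
  "pair n v1 v2 = v1 + (fin_adj (Junit n) \<rhd> v2 \<lhd> Junit n)"

definition sa :: "('v \<Rightarrow> 'v) \<Rightarrow> nat \<Rightarrow> 'v \<Rightarrow> 'v" where
  "sa star n v = (Iunit n \<rhd> v \<lhd> Junit n) + (fin_adj (Junit n) \<rhd> star v \<lhd> Iunit n)"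

definition F_independent :: "'v \<Rightarrow> 'v \<Rightarrow> bool" where
  "F_independent u v \<longleftrightarrow> (\<exists>I J. finite I \<and> finite J \<and> I \<inter> J = {} \<and>
     (\<Sum>i\<in>I. munit i i) \<rhd> u \<lhd> (\<Sum>i\<in>I. munit i i) = u \<and>
     (\<Sum>j\<in>J. munit j j) \<rhd> v \<lhd> (\<Sum>j\<in>J. munit j j) = v)"

end

text \<open>Bimodules are bimodules over a complex algebra: besides the ring bimodule axioms, the
  scalars act in the same way from both sides (\<open>scale_balanced\<close>). This has to be
  required explicitly because complex scalar multiplication is derived from the left action.
  Without it, the quaternionic analogue of the algebra, with its usual order and absolute value,
  would satisfy all axioms below, although left and right multiplication by \<open>\<i>\<close> differ there
  and the involution is not conjugate-linear.\<close>

locale F_bimodule = F_actions lact ract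
  for lact :: "fin_mat \<Rightarrow> 'v::ab_group_add \<Rightarrow> 'v" (infixr \<open>\<rhd>\<close> 75)
    and ract :: "'v \<Rightarrow> fin_mat \<Rightarrow> 'v" (infixl \<open>\<lhd>\<close> 74) +
  assumes lact_add: "a \<rhd> (u + v) = a \<rhd> u + a \<rhd> v"
    and add_lact: "(a + b) \<rhd> v = a \<rhd> v + b \<rhd> v"
    and mult_lact: "(a * b) \<rhd> v = a \<rhd> b \<rhd> v"
    and add_ract: "(u + v) \<lhd> a = (u \<lhd> a) + (v \<lhd> a)"
    and ract_add: "v \<lhd> (a + b) = (v \<lhd> a) + (v \<lhd> b)"
    and ract_mult: "v \<lhd> (a * b) = v \<lhd> a \<lhd> b"
    and lact_ract: "a \<rhd> (v \<lhd> b) = (a \<rhd> v) \<lhd> b"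
    and scale_balanced: "fin_scale \<alpha> a \<rhd> v \<lhd> b = a \<rhd> v \<lhd> fin_scale \<alpha> b"

locale nondegenerate_F_bimodule = F_bimodule +
  assumes nondegenerate: "\<exists>n\<ge>1. supported n v"

locale star_F_bimodule = F_bimodule +
  fixes star :: "'a \<Rightarrow> 'a"
  assumes star_add: "star (u + v) = star u + star v"
    and star_lact: "star (a \<rhd> v) = star v \<lhd> fin_adj a"
    and star_ract: "star (v \<lhd> a) = fin_adj a \<rhd> star v"
    and star_star: "star (star v) = v"

locale ordered_F_bimodule = star_F_bimodule +
  fixes P :: "'a set"
  assumes P_sa: "v \<in> P \<Longrightarrow> star v = v"
    and P_add: "u \<in> P \<Longrightarrow> v \<in> P \<Longrightarrow> u + v \<in> P"
    and P_conj: "v \<in> P \<Longrightarrow> fin_adj a \<rhd> v \<lhd> a \<in> P"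
begin

definition le :: "'a \<Rightarrow> 'a \<Rightarrow> bool" (infix \<open>\<preceq>\<close> 50) where
  "u \<preceq> v \<longleftrightarrow> v - u \<in> P"

end

locale nondegenerate_absolutely_ordered_F_bimodule =
  nondegenerate_F_bimodule + ordered_F_bimodule +
  fixes absv :: "'a \<Rightarrow> 'a"
  assumes absv_P: "absv v \<in> P"
    and ord_absv: "ord (absv v) \<le> ord v"
    and absv_pos: "v \<in> P \<Longrightarrow> absv v = v"
    and absv_pair: "pair (ord v) (absv (star v)) (absv v) + sa star (ord v) v \<in> P"
    and absv_conj:
      "absv (a \<rhd> v \<lhd> b) \<preceq> cscale (of_real (fin_norm a)) (absv (absv v \<lhd> b))"
    and absv_indep: "F_independent u v \<Longrightarrow> absv (u + v) = absv u + absv v"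
    and absv_hered: "u \<in> P \<Longrightarrow> v \<in> P \<Longrightarrow> w \<in> P \<Longrightarrow>
      absv (u - v) = u + v \<Longrightarrow> w \<preceq> v \<Longrightarrow> absv (u - w) = u + w"
    and absv_plus: "u \<in> P \<Longrightarrow> v \<in> P \<Longrightarrow> w \<in> P \<Longrightarrow>
      absv (u - v) = u + v \<Longrightarrow> absv (u - w) = u + w \<Longrightarrow>
      absv (u - absv (v + w)) = u + absv (v + w)"
    and absv_minus: "u \<in> P \<Longrightarrow> v \<in> P \<Longrightarrow> w \<in> P \<Longrightarrow>
      absv (u - v) = u + v \<Longrightarrow> absv (u - w) = u + w \<Longrightarrow>
      absv (u - absv (v - w)) = u + absv (v - w)"

lemma entry_sum: "entry (sum f A) i j = (\<Sum>x\<in>A. entry (f x) i j)"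
  by (induction A rule: infinite_finite_induct) auto

lemma entry_Iunit: "entry (Iunit n) i j = (if i = j \<and> i < n then 1 else 0)"
proof -
  have "entry (Iunit n) i j = (\<Sum>k<n. if k = i then (if i = j then 1 else 0) else 0)"
    unfolding Iunit_def entry_sum by (intro sum.cong) auto
  then show ?thesis by (simp add: sum.delta)
qed

lemma scaled_Iunit_mult:
  assumes "m \<le> n"
  shows "fin_scale \<alpha> (Iunit n) * Iunit m = fin_scale \<alpha> (Iunit m)"
proof (rule fin_mat_eqI)
  fix i j
  have "{k. entry (fin_scale \<alpha> (Iunit n)) i k \<noteq> 0} \<subseteq> {i}"
    by (auto simp: entry_Iunit split: if_splits)
  from entry_times_superset[OF _ this, of "Iunit m" j] assms
  show "entry (fin_scale \<alpha> (Iunit n) * Iunit m) i j = entry (fin_scale \<alpha> (Iunit m)) i j"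
    by (auto simp: entry_Iunit)
qed

lemma (in F_bimodule) cscale_eq:
  assumes "1 \<le> n" "supported n v"
  shows "cscale \<alpha> v = fin_scale \<alpha> (Iunit n) \<rhd> v"
proof -
  let ?m = "ord v"
  have m: "supported ?m v" "?m \<le> n"
    unfolding ord_def using LeastI[of "\<lambda>n. 1 \<le> n \<and> supported n v" n] assms
    by (auto intro: Least_le)
  have fixed: "Iunit ?m \<rhd> (v \<lhd> Iunit ?m) = v"
    using m(1) by (simp add: supported_def lact_ract)
  have "fin_scale \<alpha> (Iunit k) \<rhd> v = fin_scale \<alpha> (Iunit ?m) \<rhd> (v \<lhd> Iunit ?m)"
    if "?m \<le> k" for k
    using scaled_Iunit_mult[OF that] mult_lact[of "fin_scale \<alpha> (Iunit k)" "Iunit ?m" "v \<lhd> Iunit ?m"]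
    by (simp only: fixed)
  from this[OF m(2)] this[OF order_refl] show ?thesis by (simp add: cscale_def)
qed


section \<open>Absolutely matrix ordered spaces\<close>

text \<open>Vector spaces on a carrier set, with explicit operations: the spaces needed below
  (\<open>I\<^sub>1 \<VV> I\<^sub>1\<close> and the self-adjoint \<open>n \<times> n\<close> matrices over it) are not types.\<close>

locale vector_space_on =
  fixes X :: "'x set" and add :: "'x \<Rightarrow> 'x \<Rightarrow> 'x" (infixl \<open>\<oplus>\<close> 65)
    and zero :: 'x (\<open>\<zero>\<close>) and scl :: "'k::field \<Rightarrow> 'x \<Rightarrow> 'x" (infixr \<open>\<odot>\<close> 75)
  assumes add_closed: "u \<in> X \<Longrightarrow> v \<in> X \<Longrightarrow> u \<oplus> v \<in> X"
    and zero_closed: "\<zero> \<in> X"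
    and scl_closed: "v \<in> X \<Longrightarrow> k \<odot> v \<in> X"
    and add_assoc: "u \<in> X \<Longrightarrow> v \<in> X \<Longrightarrow> w \<in> X \<Longrightarrow> (u \<oplus> v) \<oplus> w = u \<oplus> (v \<oplus> w)"
    and add_comm: "u \<in> X \<Longrightarrow> v \<in> X \<Longrightarrow> u \<oplus> v = v \<oplus> u"
    and add_zero: "v \<in> X \<Longrightarrow> v \<oplus> \<zero> = v"
    and add_inverse: "v \<in> X \<Longrightarrow> v \<oplus> (- 1) \<odot> v = \<zero>"
    and scl_add: "u \<in> X \<Longrightarrow> v \<in> X \<Longrightarrow> k \<odot> (u \<oplus> v) = k \<odot> u \<oplus> k \<odot> v"
    and add_scl: "v \<in> X \<Longrightarrow> (k + l) \<odot> v = k \<odot> v \<oplus> l \<odot> v"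
    and scl_scl: "v \<in> X \<Longrightarrow> k \<odot> l \<odot> v = (k * l) \<odot> v"
    and one_scl: "v \<in> X \<Longrightarrow> 1 \<odot> v = v"
begin

definition diff :: "'x \<Rightarrow> 'x \<Rightarrow> 'x" (infixl \<open>\<ominus>\<close> 65) where
  "u \<ominus> v = u \<oplus> (- 1) \<odot> v"

end

text \<open>Properness of the cone (antisymmetry of the order) is included here; for absolutely ordered
  spaces it also follows from the remaining axioms, since \<open>v, - v \<in> pos\<close> gives
  \<open>v = |v| = |- v| = - v\<close>.\<close>

locale real_ordered_space = vector_space_on X add zero scl
  for X :: "'x set" and add (infixl \<open>\<oplus>\<close> 65) and zero (\<open>\<zero>\<close>)
    and scl :: "real \<Rightarrow> 'x \<Rightarrow> 'x" (infixr \<open>\<odot>\<close> 75) +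
  fixes pos :: "'x set"
  assumes pos_sub: "pos \<subseteq> X"
    and pos_zero: "\<zero> \<in> pos"
    and pos_add: "u \<in> pos \<Longrightarrow> v \<in> pos \<Longrightarrow> u \<oplus> v \<in> pos"
    and pos_scl: "v \<in> pos \<Longrightarrow> 0 \<le> k \<Longrightarrow> k \<odot> v \<in> pos"
    and pos_proper: "v \<in> pos \<Longrightarrow> (- 1) \<odot> v \<in> pos \<Longrightarrow> v = \<zero>"

locale absolutely_ordered_space = real_ordered_space +
  fixes av :: "'a \<Rightarrow> 'a"
  assumes av_pos: "v \<in> X \<Longrightarrow> av v \<in> pos"
    and av_id: "v \<in> pos \<Longrightarrow> av v = v"
    and av_add: "v \<in> X \<Longrightarrow> av v \<oplus> v \<in> pos"
    and av_diff: "v \<in> X \<Longrightarrow> av v \<ominus> v \<in> pos"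
    and av_scl: "v \<in> X \<Longrightarrow> av (k \<odot> v) = \<bar>k\<bar> \<odot> av v"
    and av_hered: "u \<in> X \<Longrightarrow> v \<in> X \<Longrightarrow> w \<in> X \<Longrightarrow> av (u \<ominus> v) = u \<oplus> v \<Longrightarrow>
      w \<in> pos \<Longrightarrow> v \<ominus> w \<in> pos \<Longrightarrow> av (u \<ominus> w) = u \<oplus> w"
    and av_plus: "u \<in> X \<Longrightarrow> v \<in> X \<Longrightarrow> w \<in> X \<Longrightarrow> av (u \<ominus> v) = u \<oplus> v \<Longrightarrow>
      av (u \<ominus> w) = u \<oplus> w \<Longrightarrow> av (u \<ominus> av (v \<oplus> w)) = u \<oplus> av (v \<oplus> w)"
    and av_minus: "u \<in> X \<Longrightarrow> v \<in> X \<Longrightarrow> w \<in> X \<Longrightarrow> av (u \<ominus> v) = u \<oplus> v \<Longrightarrow>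
      av (u \<ominus> w) = u \<oplus> w \<Longrightarrow> av (u \<ominus> av (v \<ominus> w)) = u \<oplus> av (v \<ominus> w)"

definition mats :: "'v set \<Rightarrow> nat \<Rightarrow> nat \<Rightarrow> 'v mat set" where
  "mats V m n = {A \<in> carrier_mat m n. elements_mat A \<subseteq> V}"

definition adj_mat :: "('v \<Rightarrow> 'v) \<Rightarrow> 'v mat \<Rightarrow> 'v mat" where
  "adj_mat star A = map_mat star (transpose_mat A)"

definition sa_mats :: "'v set \<Rightarrow> ('v \<Rightarrow> 'v) \<Rightarrow> nat \<Rightarrow> 'v mat set" where
  "sa_mats V star n = {A \<in> mats V n n. adj_mat star A = A}"

definition lmul :: "(complex \<Rightarrow> 'v \<Rightarrow> 'v::ab_group_add) \<Rightarrow> complex mat \<Rightarrow> 'v mat \<Rightarrow> 'v mat" where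
  "lmul scale \<alpha> v = mat (dim_row \<alpha>) (dim_col v)
     (\<lambda>(i, k). \<Sum>j<dim_row v. scale (\<alpha> $$ (i, j)) (v $$ (j, k)))"

definition rmul :: "(complex \<Rightarrow> 'v \<Rightarrow> 'v::ab_group_add) \<Rightarrow> 'v mat \<Rightarrow> complex mat \<Rightarrow> 'v mat" where
  "rmul scale v \<beta> = mat (dim_row v) (dim_col \<beta>)
     (\<lambda>(i, k). \<Sum>j<dim_col v. scale (\<beta> $$ (j, k)) (v $$ (i, j)))"

definition dsum :: "'v::zero mat \<Rightarrow> 'v mat \<Rightarrow> 'v mat" where
  "dsum v w = four_block_mat v (0\<^sub>m (dim_row v) (dim_col w)) (0\<^sub>m (dim_row w) (dim_col v)) w"

definition vec_norm :: "complex vec \<Rightarrow> real" where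
  "vec_norm x = L2_set (\<lambda>i. cmod (x $ i)) {..<dim_vec x}"

definition mat_norm :: "complex mat \<Rightarrow> real" where
  "mat_norm \<alpha> = (SUP x \<in> {x \<in> carrier_vec (dim_col \<alpha>). vec_norm x \<le> 1}. vec_norm (\<alpha> *\<^sub>v x))"

text \<open>A matrix ordered space on a carrier \<open>V\<close> inside an additive group; \<open>C n\<close> is the cone
  \<open>M\<^sub>n(V)\<^sup>+\<close>.\<close>

locale matrix_ordered_space =
  vector_space_on V "(+)" 0 scale
  for V :: "'v::ab_group_add set" and scale :: "complex \<Rightarrow> 'v \<Rightarrow> 'v" +
  fixes star :: "'v \<Rightarrow> 'v" and C :: "nat \<Rightarrow> 'v mat set"
  assumes star_closed: "v \<in> V \<Longrightarrow> star v \<in> V"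
    and star_add: "u \<in> V \<Longrightarrow> v \<in> V \<Longrightarrow> star (u + v) = star u + star v"
    and star_scale: "v \<in> V \<Longrightarrow> star (scale k v) = scale (cnj k) (star v)"
    and star_star: "v \<in> V \<Longrightarrow> star (star v) = v"
    and ordered: "1 \<le> n \<Longrightarrow> real_ordered_space (sa_mats V star n) (+) (0\<^sub>m n n)
      (\<lambda>r. map_mat (scale (of_real r))) (C n)"
    and cone_conj: "1 \<le> m \<Longrightarrow> 1 \<le> n \<Longrightarrow> A \<in> C n \<Longrightarrow> \<alpha> \<in> carrier_mat n m \<Longrightarrow>
      rmul scale (lmul scale (adj_mat cnj \<alpha>) A) \<alpha> \<in> C m"

text \<open>\<open>av m n\<close> is the absolute value on the \<open>m \<times> n\<close> matrices, with values in \<open>C n\<close>.\<close>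

locale absolutely_matrix_ordered_space = matrix_ordered_space +
  fixes av :: "nat \<Rightarrow> nat \<Rightarrow> 'a mat \<Rightarrow> 'a mat"
  assumes av_cone: "1 \<le> m \<Longrightarrow> 1 \<le> n \<Longrightarrow> v \<in> mats V m n \<Longrightarrow> av m n v \<in> C n"
    and av_ordered: "1 \<le> n \<Longrightarrow> absolutely_ordered_space (sa_mats V star n) (+) (0\<^sub>m n n)
      (\<lambda>r. map_mat (scale (of_real r))) (C n) (av n n)"
    and av_conj: "1 \<le> m \<Longrightarrow> 1 \<le> n \<Longrightarrow> 1 \<le> r \<Longrightarrow> 1 \<le> s \<Longrightarrow> v \<in> mats V m n \<Longrightarrow>
      \<alpha> \<in> carrier_mat r m \<Longrightarrow> \<beta> \<in> carrier_mat n s \<Longrightarrow>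
      map_mat (scale (of_real (mat_norm \<alpha>))) (av n s (rmul scale (av m n v) \<beta>))
        - av r s (rmul scale (lmul scale \<alpha> v) \<beta>) \<in> C s"
    and av_dsum: "1 \<le> m \<Longrightarrow> 1 \<le> n \<Longrightarrow> 1 \<le> r \<Longrightarrow> 1 \<le> s \<Longrightarrow>
      v \<in> mats V m n \<Longrightarrow> w \<in> mats V r s \<Longrightarrow>
      av (m + r) (n + s) (dsum v w) = dsum (av m n v) (av r s w)"

text \<open>The version in which only the absolute values of square matrices are prescribed.\<close>

definition absolutely_matrix_ordered_space_sq ::
  "'v::ab_group_add set \<Rightarrow> (complex \<Rightarrow> 'v \<Rightarrow> 'v) \<Rightarrow> ('v \<Rightarrow> 'v) \<Rightarrow> (nat \<Rightarrow> 'v mat set) \<Rightarrow>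
    (nat \<Rightarrow> 'v mat \<Rightarrow> 'v mat) \<Rightarrow> bool" where
  "absolutely_matrix_ordered_space_sq V scale star C sq \<longleftrightarrow>
     (\<exists>av. (\<forall>n\<ge>1. \<forall>v\<in>mats V n n. av n n v = sq n v) \<and>
           absolutely_matrix_ordered_space V scale star C av)"


section \<open>Matricial inductive limits\<close>

definition fin_of_mat :: "complex mat \<Rightarrow> fin_mat" where
  "fin_of_mat \<alpha> = (\<Sum>i<dim_row \<alpha>. \<Sum>j<dim_col \<alpha>. fin_scale (\<alpha> $$ (i, j)) (munit i j))"

context F_actions
begin

definition T :: "nat \<Rightarrow> 'v mat \<Rightarrow> 'v" where
  "T n A = (\<Sum>i<n. \<Sum>j<n. munit i 0 \<rhd> A $$ (i, j) \<lhd> munit 0 j)"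

definition T_inv :: "nat \<Rightarrow> 'v \<Rightarrow> 'v mat" where
  "T_inv n = inv_into (mats (corner 1) n n) (T n)"

definition mat_cone :: "'v set \<Rightarrow> nat \<Rightarrow> 'v mat set" where
  "mat_cone P n = {A \<in> mats (corner 1) n n. T n A \<in> (\<lambda>p. Iunit n \<rhd> p \<lhd> Iunit n) ` P}"

definition mat_abs :: "('v \<Rightarrow> 'v) \<Rightarrow> nat \<Rightarrow> 'v mat \<Rightarrow> 'v mat" where
  "mat_abs absv n A = T_inv n (absv (T n A))"

text \<open>The bimodule, with involution \<open>star\<close>, cone \<open>P\<close> and absolute value \<open>absv\<close>, is via the maps
  \<open>T n\<close> the matricial inductive limit of the space \<open>corner 1\<close> with cones \<open>C n\<close> and absolute
  values \<open>sq n\<close>: the \<open>T n\<close> identify the matrices over \<open>corner 1\<close>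
  with the corners of the bimodule, compatibly with \<open>v \<mapsto> v \<oplus> 0\<close> and with all structure.\<close>

definition matricial_inductive_limit ::
  "('v \<Rightarrow> 'v) \<Rightarrow> 'v set \<Rightarrow> ('v \<Rightarrow> 'v) \<Rightarrow> (nat \<Rightarrow> 'v mat set) \<Rightarrow> (nat \<Rightarrow> 'v mat \<Rightarrow> 'v mat) \<Rightarrow> bool" where
  "matricial_inductive_limit star P absv C sq \<longleftrightarrow>
     (\<forall>n\<ge>1. bij_betw (T n) (mats (corner 1) n n) (corner n)) \<and>
     (\<forall>n\<ge>1. \<forall>v\<in>mats (corner 1) n n. \<forall>w\<in>mats (corner 1) n n. T n (v + w) = T n v + T n w) \<and>
     (\<forall>n\<ge>1. \<forall>v\<in>mats (corner 1) n n. \<forall>\<alpha>. T n (map_mat (cscale \<alpha>) v) = cscale \<alpha> (T n v)) \<and>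
     (\<forall>n\<ge>1. \<forall>v\<in>mats (corner 1) n n. T n (adj_mat star v) = star (T n v)) \<and>
     (\<forall>n\<ge>1. \<forall>v\<in>mats (corner 1) n n. \<forall>\<alpha>\<in>carrier_mat n n. \<forall>\<beta>\<in>carrier_mat n n.
        T n (rmul cscale (lmul cscale \<alpha> v) \<beta>) = fin_of_mat \<alpha> \<rhd> T n v \<lhd> fin_of_mat \<beta>) \<and>
     (\<forall>n\<ge>1. \<forall>m\<ge>1. \<forall>v\<in>mats (corner 1) n n. T (n + m) (dsum v (0\<^sub>m m m)) = T n v) \<and>
     UNIV = (\<Union>n\<in>{1..}. T n ` mats (corner 1) n n) \<and>
     P = (\<Union>n\<in>{1..}. T n ` C n) \<and>
     (\<forall>v. absv v = T (ord v) (sq (ord v) (T_inv (ord v) v)))"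

end

end

theory Submission
  imports Defs
begin

text \<open>Everything happens inside the bimodule, where an \<open>m \<times> n\<close> matrix over \<open>corner 1\<close> becomes an
  element supported on an \<open>m \<times> n\<close> block. Sandwiching with the contraction axiom shows that a
  partial isometry on the left does not change the absolute value, and that \<open>|v|\<close> lives on the
  columns of \<open>v\<close>; so \<open>|\<cdot>|\<close> maps \<open>m \<times> n\<close> blocks to \<open>n \<times> n\<close> blocks and supplies the rectangular
  absolute values. Additivity on direct sums reduces to additivity on independent elements after
  shifting rows; \<open>|v| \<plusminus> v \<ge> 0\<close> is the positivity axiom for the pair compressed by \<open>1 \<plusminus> J\<^sup>*\<close>.\<close>

section \<open>Finitely supported matrices\<close>

text \<open>Two features of the axioms shape the proof. Equalities of absolute values come out as
  pairs of inequalities, yet antisymmetry of the order is not an axiom on \<open>P\<close>; it has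
  to be extracted from \<open>absv_hered\<close>. And the contraction axiom is asymmetric: a left
  factor is absorbed by its norm, whereas a right factor b merely moves inside, leaving | |v| b |.
  This becomes computable because w b = b (b* w b) for positive w fixed by b b*, which turns the
  right factor into a left one acting on a positive element. The algebra has no unit, so
  \<open>Iunit n\<close> with n large enough for all elements at hand plays that role. Column
  support is the crux for rectangular matrices: the axiom on orders only confines |v| to a square
  corner containing rows and columns of v, while for an m x n matrix with m > n the value must lie
  in the smaller n x n corner.\<close>

lemma entry_munit_mult: "entry (munit i j * a) k l = (if k = i then entry a j l else 0)"
proof -
  have "{m. entry (munit i j) k m \<noteq> 0} \<subseteq> {j}" by auto
  from entry_times_superset[OF _ this] show ?thesis by simp
qed

text \<open>Matrix units, truncated identities, \<open>Junit\<close>, shifts and sign matrices have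
  at most one non-zero entry in each row and column, so this lemma and its mirror image compute
  their products without sums.\<close>

lemma entry_times_monomial:
  assumes "\<And>m. entry a k m \<noteq> 0 \<Longrightarrow> m = j"
  shows "entry (a * b) k l = entry a k j * entry b j l"
proof -
  have "{m. entry a k m \<noteq> 0} \<subseteq> {j}" using assms by auto
  from entry_times_superset[OF _ this] show ?thesis by simp
qed

lemma entry_times_right_monomial:
  assumes "\<And>m. entry b m l \<noteq> 0 \<Longrightarrow> m = j"
  shows "entry (a * b) k l = entry a k j * entry b j l"
proof -
  \<comment> \<open>The product sums over the support of row \<open>k\<close> of \<open>a\<close>,
    which may miss \<open>j\<close>; inserting \<open>j\<close> allows the sum to be cut down to
    this one index.\<close>
  have "entry (a * b) k l = (\<Sum>m\<in>insert j {m. entry a k m \<noteq> 0}. entry a k m * entry b m l)"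
    by (rule entry_times_superset) (auto simp: finite_row)
  also have "\<dots> = (\<Sum>m\<in>{j}. entry a k m * entry b m l)"
    by (rule sum.mono_neutral_right) (use assms in \<open>auto simp: finite_row\<close>)
  finally show ?thesis by simp
qed

lemma entry_mult_munit: "entry (a * munit i j) k l = (if l = j then entry a k i else 0)"
  by (subst entry_times_right_monomial[of _ _ i]) (auto split: if_splits)

lemma munit_mult_munit: "munit i j * munit k l = (if j = k then munit i l else 0)"
  by (rule fin_mat_eqI) (auto simp: entry_munit_mult)

lemma fin_adj_munit [simp]: "fin_adj (munit i j) = munit j i"
  by (rule fin_mat_eqI) auto

lemma fin_adj_adj [simp]: "fin_adj (fin_adj a) = a"
  by (rule fin_mat_eqI) simp

lemma fin_scale_1 [simp]: "fin_scale 1 a = a"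
  by (rule fin_mat_eqI) simp

lemma fin_scale_0 [simp]: "fin_scale 0 a = 0"
  by (rule fin_mat_eqI) simp

lemma fin_scale_scale: "fin_scale \<alpha> (fin_scale \<beta> a) = fin_scale (\<alpha> * \<beta>) a"
  by (rule fin_mat_eqI) simp

lemma fin_scale_mult_left: "fin_scale \<alpha> a * b = fin_scale \<alpha> (a * b)"
proof (rule fin_mat_eqI)
  fix i j
  have "entry (fin_scale \<alpha> a * b) i j
      = (\<Sum>k | entry a i k \<noteq> 0. entry (fin_scale \<alpha> a) i k * entry b k j)"
    by (rule entry_times_superset) (auto simp: finite_row)
  then show "entry (fin_scale \<alpha> a * b) i j = entry (fin_scale \<alpha> (a * b)) i j"
    by (simp add: entry_times sum_distrib_left mult.assoc)
qed

lemma fin_scale_mult_right: "a * fin_scale \<alpha> b = fin_scale \<alpha> (a * b)"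
  by (rule fin_mat_eqI) (simp add: entry_times sum_distrib_left mult.left_commute)

lemma fin_scale_add: "fin_scale (\<alpha> + \<beta>) a = fin_scale \<alpha> a + fin_scale \<beta> a"
  by (rule fin_mat_eqI) (simp add: algebra_simps)

lemma fin_adj_scale: "fin_adj (fin_scale \<alpha> a) = fin_scale (cnj \<alpha>) (fin_adj a)"
  by (rule fin_mat_eqI) simp

lemma fin_adj_add: "fin_adj (a + b) = fin_adj a + fin_adj b"
  by (rule fin_mat_eqI) simp

lemma fin_adj_diff: "fin_adj (a - b) = fin_adj a - fin_adj b"
  by (rule fin_mat_eqI) simp

lemma fin_adj_Iunit [simp]: "fin_adj (Iunit n) = Iunit n"
  by (rule fin_mat_eqI) (simp add: entry_Iunit)

lemma entry_Junit: "entry (Junit n) i j = (if i < n \<and> j = n + i then 1 else 0)"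
proof -
  have "entry (Junit n) i j = (\<Sum>k<n. if k = i then (if j = n + i then 1 else 0) else 0)"
    unfolding Junit_def entry_sum by (intro sum.cong) auto
  then show ?thesis by (simp add: sum.delta)
qed

lemma Iunit_mult_Iunit [simp]: "Iunit m * Iunit n = Iunit (min m n)"
proof (rule fin_mat_eqI)
  fix k l
  show "entry (Iunit m * Iunit n) k l = entry (Iunit (min m n)) k l"
    by (subst entry_times_monomial[of _ _ k]) (auto simp: entry_Iunit split: if_splits)
qed

lemma entry_Iunit_mult: "entry (Iunit n * a) i j = (if i < n then entry a i j else 0)"
  by (subst entry_times_monomial[of _ _ i]) (auto simp: entry_Iunit split: if_splits)

lemma entry_mult_Iunit: "entry (a * Iunit n) i j = (if j < n then entry a i j else 0)"
  by (subst entry_times_right_monomial[of _ _ j]) (auto simp: entry_Iunit split: if_splits)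

text \<open>For \<open>f\<close> injective on a finite \<open>A\<close>, this is the partial
  isometry that sends the basis vector with index i in \<open>A\<close> to the one with index
  \<open>f i\<close> and kills the others. Shifts of rows act by it from the left, shifts of columns
  by its adjoint from the right.\<close>

definition pinj :: "nat set \<Rightarrow> (nat \<Rightarrow> nat) \<Rightarrow> fin_mat" where
  "pinj A f = (\<Sum>i\<in>A. munit (f i) i)"

abbreviation dproj :: "nat set \<Rightarrow> fin_mat" where
  "dproj A \<equiv> \<Sum>i\<in>A. munit i i"

lemma entry_pinj:
  assumes "finite A"
  shows "entry (pinj A f) k l = (if l \<in> A \<and> k = f l then 1 else 0)"
proof -
  have "entry (pinj A f) k l = (\<Sum>i\<in>A. if i = l then (if k = f l then 1 else 0) else 0)"
    unfolding pinj_def entry_sum by (intro sum.cong) auto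
  then show ?thesis using assms by (simp add: sum.delta)
qed

lemma entry_dproj:
  assumes "finite A"
  shows "entry (dproj A) k l = (if l \<in> A \<and> k = l then 1 else 0)"
  using entry_pinj[OF assms, of "\<lambda>i. i"] by (simp add: pinj_def)

lemma Iunit_eq_dproj: "Iunit n = dproj {..<n}"
  by (simp add: Iunit_def)

lemma pinj_mult_pinj:
  assumes "finite A" "finite B" "g ` B \<subseteq> A"
  shows "pinj A f * pinj B g = pinj B (\<lambda>i. f (g i))"
proof (rule fin_mat_eqI)
  fix k l
  show "entry (pinj A f * pinj B g) k l = entry (pinj B (\<lambda>i. f (g i))) k l"
    using assms by (subst entry_times_right_monomial[of _ _ "g l"])
      (auto simp: entry_pinj split: if_splits)
qed

lemma adj_pinj_mult_pinj:
  assumes "finite A" "inj_on f A"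
  shows "fin_adj (pinj A f) * pinj A f = dproj A"
proof (rule fin_mat_eqI)
  fix k l
  show "entry (fin_adj (pinj A f) * pinj A f) k l = entry (dproj A) k l"
    using assms by (subst entry_times_monomial[of _ _ "f k"])
      (auto simp: entry_pinj entry_dproj inj_on_def split: if_splits)
qed

lemma pinj_mult_adj_pinj:
  assumes "finite A" "inj_on f A"
  shows "pinj A f * fin_adj (pinj A f) = dproj (f ` A)"
proof (rule fin_mat_eqI)
  fix k l
  show "entry (pinj A f * fin_adj (pinj A f)) k l = entry (dproj (f ` A)) k l"
  proof (cases "k \<in> f ` A")
    case True
    then obtain i where "i \<in> A" "k = f i" by blast
    then show ?thesis using assms by (subst entry_times_monomial[of _ _ i])
      (auto simp: entry_pinj entry_dproj inj_on_def split: if_splits)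
  next
    case False
    \<comment> \<open>Row \<open>k\<close> of the left factor is zero here, so the column index may
      be anything; 0 is arbitrary.\<close>
    then show ?thesis using assms by (subst entry_times_monomial[of _ _ 0])
      (auto simp: entry_pinj entry_dproj inj_on_def split: if_splits)
  qed
qed

lemma dproj_mult_pinj:
  assumes "finite A" "finite B" "f ` A \<subseteq> B"
  shows "dproj B * pinj A f = pinj A f"
  using pinj_mult_pinj[OF assms(2,1,3), of "\<lambda>i. i"] by (simp add: pinj_def)

lemma dproj_mult_dproj:
  assumes "finite A" "finite B"
  shows "dproj A * dproj B = dproj (A \<inter> B)"
proof (rule fin_mat_eqI)
  fix k l
  show "entry (dproj A * dproj B) k l = entry (dproj (A \<inter> B)) k l"
    using assms by (subst entry_times_monomial[of _ _ k]) (auto simp: entry_dproj split: if_splits)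
qed

lemma fin_adj_dproj: "finite A \<Longrightarrow> fin_adj (dproj A) = dproj A"
  by (rule fin_mat_eqI) (auto simp: entry_dproj)

lemma fin_adj_mult: "fin_adj (a * b) = fin_adj b * fin_adj a"
proof (rule fin_mat_eqI)
  fix i j
  \<comment> \<open>The two products sum over supports of different rows; both are extended to the
    union.\<close>
  let ?S = "{k. entry a j k \<noteq> 0} \<union> {k. entry (fin_adj b) i k \<noteq> 0}"
  have fin: "finite ?S" by (intro finite_UnI finite_row)
  have "entry (fin_adj (a * b)) i j = cnj (\<Sum>k\<in>?S. entry a j k * entry b k i)"
    by (simp only: entry_fin_adj) (subst entry_times_superset[OF fin], auto)
  also have "\<dots> = (\<Sum>k\<in>?S. entry (fin_adj b) i k * entry (fin_adj a) k j)"
    by (simp add: mult.commute)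
  also have "\<dots> = entry (fin_adj b * fin_adj a) i j"
    by (rule entry_times_superset[OF fin, symmetric]) auto
  finally show "entry (fin_adj (a * b)) i j = entry (fin_adj b * fin_adj a) i j" .
qed

section \<open>Upper bounds for the operator norm\<close>

lemma seq_norm_superset:
  assumes "finite S" "{i. x i \<noteq> 0} \<subseteq> S"
  shows "seq_norm x = L2_set (\<lambda>i. cmod (x i)) S"
proof -
  have "(\<Sum>i | x i \<noteq> 0. (cmod (x i))\<^sup>2) = (\<Sum>i\<in>S. (cmod (x i))\<^sup>2)"
    using assms by (intro sum.mono_neutral_left) auto
  then show ?thesis by (simp add: seq_norm_def L2_set_def)
qed

text \<open>Distinct coordinates of a sequence go to distinct coordinates, each multiplied by a
  number of modulus at most \<open>c\<close>, so the squared moduli add up without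
  interference.\<close>

lemma fin_norm_le_monomial:
  assumes f: "inj_on f A"
    and a: "\<And>k l. entry a k l \<noteq> 0 \<Longrightarrow> l \<in> A \<and> k = f l"
    and c: "\<And>k l. cmod (entry a k l) \<le> c"
  shows "fin_norm a \<le> c"
  unfolding fin_norm_def
proof (rule cSUP_least)
  have "(\<lambda>_. 0) \<in> {x. finite {j. x j \<noteq> 0} \<and> seq_norm x \<le> 1}"
    by (simp add: seq_norm_def)
  then show "{x. finite {j. x j \<noteq> 0} \<and> seq_norm x \<le> 1} \<noteq> {}" by (metis empty_iff)
next
  fix x :: "nat \<Rightarrow> complex" assume x: "x \<in> {x. finite {j. x j \<noteq> 0} \<and> seq_norm x \<le> 1}"
  have c0: "0 \<le> c" by (rule order_trans[OF norm_ge_zero c[of 0 0]])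
  let ?B = "{j. x j \<noteq> 0} \<inter> A"
  let ?y = "\<lambda>i. \<Sum>j | x j \<noteq> 0. entry a i j * x j"
  have fin: "finite ?B" using x by simp
  have y: "?y (f j) = entry a (f j) j * x j" if j: "j \<in> ?B" for j
  proof -
    have "?y (f j) = (\<Sum>j\<in>{j}. entry a (f j) j * x j)"
    proof (rule sum.mono_neutral_cong_right)
      show "\<forall>i\<in>{j. x j \<noteq> 0} - {j}. entry a (f j) i * x i = 0"
      proof
        fix i assume i: "i \<in> {j. x j \<noteq> 0} - {j}"
        have "entry a (f j) i = 0"
        proof (rule ccontr)
          assume "entry a (f j) i \<noteq> 0"
          from a[OF this] f j i show False by (auto dest: inj_onD)
        qed
        then show "entry a (f j) i * x i = 0" by simp
      qed
    qed (use x j in auto)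
    then show ?thesis by simp
  qed
  have "{i. ?y i \<noteq> 0} \<subseteq> f ` ?B"
  proof
    fix i assume "i \<in> {i. ?y i \<noteq> 0}"
    then have "?y i \<noteq> 0" by simp
    then obtain j where "x j \<noteq> 0" "entry a i j * x j \<noteq> 0"
      by (rule sum.not_neutral_contains_not_neutral) simp
    with a[of i j] show "i \<in> f ` ?B" by auto
  qed
  then have "seq_norm ?y = L2_set (\<lambda>i. cmod (?y i)) (f ` ?B)"
    using fin by (intro seq_norm_superset) auto
  also have "\<dots> = L2_set (\<lambda>j. cmod (?y (f j))) ?B"
    using f by (simp add: L2_set_def sum.reindex inj_on_subset)
  also have "\<dots> \<le> L2_set (\<lambda>j. c * cmod (x j)) ?B"
    by (rule L2_set_mono) (simp_all add: y norm_mult mult_right_mono c)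
  also have "\<dots> = c * L2_set (\<lambda>j. cmod (x j)) ?B"
    using c0 by (simp add: L2_set_right_distrib)
  also have "\<dots> \<le> c * L2_set (\<lambda>j. cmod (x j)) {j. x j \<noteq> 0}"
    unfolding L2_set_def using x c0
    by (intro mult_left_mono real_sqrt_le_mono sum_mono2) auto
  also have "\<dots> \<le> c * 1"
    using x c0 by (intro mult_left_mono) (auto simp: seq_norm_def)
  finally show "seq_norm ?y \<le> c" by simp
qed

lemma fin_norm_scale_Iunit: "fin_norm (fin_scale \<alpha> (Iunit n)) \<le> cmod \<alpha>"
  by (rule fin_norm_le_monomial[of "\<lambda>i. i" UNIV]) (auto simp: entry_Iunit split: if_splits)

lemma fin_norm_Iunit: "fin_norm (Iunit n) \<le> 1"
  using fin_norm_scale_Iunit[of 1] by simp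

lemma fin_norm_pinj: "finite A \<Longrightarrow> inj_on f A \<Longrightarrow> fin_norm (pinj A f) \<le> 1"
  by (rule fin_norm_le_monomial[of f A]) (auto simp: entry_pinj split: if_splits)

lemma fin_norm_adj_pinj:
  assumes "finite A" "inj_on f A"
  shows "fin_norm (fin_adj (pinj A f)) \<le> 1"
  using assms
  by (intro fin_norm_le_monomial[of "inv_into A f" "f ` A"])
     (auto simp: entry_pinj inj_on_inv_into split: if_splits)

lemma entry_fin_of_mat:
  "entry (fin_of_mat \<alpha>) i j = (if i < dim_row \<alpha> \<and> j < dim_col \<alpha> then \<alpha> $$ (i, j) else 0)"
proof -
  have "entry (fin_of_mat \<alpha>) i j =
    (\<Sum>k<dim_row \<alpha>. if k = i then (\<Sum>l<dim_col \<alpha>. if l = j then \<alpha> $$ (i, j) else 0) else 0)"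
    unfolding fin_of_mat_def entry_sum by (rule sum.cong[OF refl]) (auto simp: if_distrib cong: if_cong intro!: sum.neutral)
  then show ?thesis by (simp add: sum.delta)
qed

text \<open>Truncating a sequence to the first \<open>dim_col \<alpha>\<close> coordinates leaves
  its image unchanged and does not increase its norm, so each value in the left supremum is bounded
  by one in the right supremum.\<close>

lemma fin_norm_fin_of_mat: "fin_norm (fin_of_mat \<alpha>) \<le> mat_norm \<alpha>"
  unfolding fin_norm_def
proof (rule cSUP_least)
  have "(\<lambda>_. 0) \<in> {x. finite {j. x j \<noteq> 0} \<and> seq_norm x \<le> 1}"
    by (simp add: seq_norm_def)
  then show "{x. finite {j. x j \<noteq> 0} \<and> seq_norm x \<le> 1} \<noteq> {}" by (metis empty_iff)
next
  let ?m = "dim_row \<alpha>" and ?n = "dim_col \<alpha>"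
  fix x :: "nat \<Rightarrow> complex" assume x: "x \<in> {x. finite {j. x j \<noteq> 0} \<and> seq_norm x \<le> 1}"
  define y where "y = vec ?n x"
  have "vec_norm y = L2_set (\<lambda>i. cmod (x i)) {..<?n}"
    by (simp add: vec_norm_def y_def L2_set_def)
  also have "\<dots> \<le> L2_set (\<lambda>i. cmod (x i)) ({..<?n} \<union> {j. x j \<noteq> 0})"
    unfolding L2_set_def using x by (intro real_sqrt_le_mono sum_mono2) auto
  also have "\<dots> = seq_norm x" using x by (intro seq_norm_superset[symmetric]) auto
  finally have y1: "vec_norm y \<le> 1" using x by simp
  let ?z = "\<lambda>i. \<Sum>j | x j \<noteq> 0. entry (fin_of_mat \<alpha>) i j * x j"
  have z: "?z i = (\<alpha> *\<^sub>v y) $ i" if "i < ?m" for i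
  proof -
    have "?z i = (\<Sum>j\<in>{j. x j \<noteq> 0} \<union> {..<?n}. entry (fin_of_mat \<alpha>) i j * x j)"
      using x by (intro sum.mono_neutral_left) auto
    also have "\<dots> = (\<Sum>j<?n. \<alpha> $$ (i, j) * x j)"
      using x that by (intro sum.mono_neutral_cong_right) (auto simp: entry_fin_of_mat)
    also have "\<dots> = (\<alpha> *\<^sub>v y) $ i"
      using that by (simp add: y_def scalar_prod_def atLeast0LessThan)
    finally show ?thesis .
  qed
  have "seq_norm ?z = L2_set (\<lambda>i. cmod (?z i)) {..<?m}"
  proof (rule seq_norm_superset)
    show "{i. ?z i \<noteq> 0} \<subseteq> {..<?m}"
    proof
      fix i assume "i \<in> {i. ?z i \<noteq> 0}"
      moreover have "?z i = 0" if "\<not> i < ?m" using that by (simp add: entry_fin_of_mat)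
      ultimately show "i \<in> {..<?m}" by auto
    qed
  qed simp
  also have "\<dots> = vec_norm (\<alpha> *\<^sub>v y)"
    by (simp add: vec_norm_def L2_set_def z)
  also have "\<dots> \<le> mat_norm \<alpha>"
    unfolding mat_norm_def
  proof (rule cSUP_upper)
    show "y \<in> {x \<in> carrier_vec ?n. vec_norm x \<le> 1}" using y1 by (simp add: y_def)
    \<comment> \<open>Coordinates of a vector in the unit ball have modulus at most 1, so the sum of
      the moduli of all entries is a crude bound.\<close>
    show "bdd_above ((\<lambda>x. vec_norm (\<alpha> *\<^sub>v x)) ` {x \<in> carrier_vec ?n. vec_norm x \<le> 1})"
    proof (rule bdd_aboveI2)
      fix v :: "complex vec" assume v: "v \<in> {x \<in> carrier_vec ?n. vec_norm x \<le> 1}"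
      have v1: "cmod (v $ j) \<le> 1" if "j < ?n" for j
      proof -
        have "cmod (v $ j) \<le> L2_set (\<lambda>i. cmod (v $ i)) {..<?n}"
          using that by (intro member_le_L2_set) auto
        then show ?thesis using v by (auto simp: vec_norm_def)
      qed
      have "vec_norm (\<alpha> *\<^sub>v v) \<le> (\<Sum>i<?m. cmod ((\<alpha> *\<^sub>v v) $ i))"
        unfolding vec_norm_def using L2_set_le_sum[of "{..<?m}" "\<lambda>i. cmod ((\<alpha> *\<^sub>v v) $ i)"] by simp
      also have "\<dots> \<le> (\<Sum>i<?m. \<Sum>j<?n. cmod (\<alpha> $$ (i, j)))"
      proof (rule sum_mono)
        fix i assume "i \<in> {..<?m}"
        then have "cmod ((\<alpha> *\<^sub>v v) $ i) = cmod (\<Sum>j<?n. \<alpha> $$ (i, j) * v $ j)"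
          using v by (auto simp: scalar_prod_def atLeast0LessThan)
        also have "\<dots> \<le> (\<Sum>j<?n. cmod (\<alpha> $$ (i, j) * v $ j))" by (rule norm_sum)
        also have "\<dots> \<le> (\<Sum>j<?n. cmod (\<alpha> $$ (i, j)))"
          by (rule sum_mono) (auto simp: norm_mult intro: mult_left_le v1)
        finally show "cmod ((\<alpha> *\<^sub>v v) $ i) \<le> (\<Sum>j<?n. cmod (\<alpha> $$ (i, j)))" .
      qed
      finally show "vec_norm (\<alpha> *\<^sub>v v) \<le> (\<Sum>i<?m. \<Sum>j<?n. cmod (\<alpha> $$ (i, j)))" .
    qed
  qed
  finally show "seq_norm ?z \<le> mat_norm \<alpha>" .
qed

text \<open>For n at least this \<open>N\<close>, \<open>Iunit n\<close> is a two-sided unit for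
  \<open>a\<close>.\<close>

lemma entries_vanish_beyond: "\<exists>N. \<forall>i\<ge>N. \<forall>j. entry a i j = 0 \<and> entry a j i = 0"
proof -
  have fin: "finite (fst ` {(i, j). entry a i j \<noteq> 0} \<union> snd ` {(i, j). entry a i j \<noteq> 0})"
    (is "finite ?S") by (simp add: finite_entry)
  then obtain N where N: "?S \<subseteq> {..<N}" unfolding finite_nat_set_iff_bounded by blast
  have "entry a i j = 0 \<and> entry a j i = 0" if "i \<ge> N" for i j
  proof -
    have "i \<notin> ?S" using N that by (meson lessThan_iff not_less subsetD)
    then show ?thesis by force
  qed
  then show ?thesis by blast
qed

lemma sum_lessThan_add: "(\<Sum>i<m + (n::nat). f i) = (\<Sum>i<m. f i) + (\<Sum>i<n. f (m + i) :: 'a::comm_monoid_add)"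
  by (induction n) (simp_all add: add.assoc)

lemma Iunit_1: "Iunit 1 = munit 0 0"
  by (simp add: Iunit_def One_nat_def lessThan_Suc)

lemma pinj_mult_munit: "finite A \<Longrightarrow> i \<in> A \<Longrightarrow> pinj A f * munit i j = munit (f i) j"
  by (rule fin_mat_eqI) (simp add: entry_mult_munit entry_pinj)

lemma fin_of_mat_mult_munit:
  assumes "\<alpha> \<in> carrier_mat r m" "j < m"
  shows "fin_of_mat \<alpha> * munit j k = (\<Sum>i<r. fin_scale (\<alpha> $$ (i, j)) (munit i k))"
proof (rule fin_mat_eqI)
  fix p q
  have "entry (\<Sum>i<r. fin_scale (\<alpha> $$ (i, j)) (munit i k)) p q
      = (\<Sum>i<r. if i = p then (if q = k then \<alpha> $$ (p, j) else 0) else 0)"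
    unfolding entry_sum by (intro sum.cong) auto
  then show "entry (fin_of_mat \<alpha> * munit j k) p q
      = entry (\<Sum>i<r. fin_scale (\<alpha> $$ (i, j)) (munit i k)) p q"
    using assms by (simp add: entry_mult_munit entry_fin_of_mat sum.delta)
qed

lemma munit_mult_fin_of_mat:
  assumes "\<beta> \<in> carrier_mat n s" "j < n"
  shows "munit k j * fin_of_mat \<beta> = (\<Sum>i<s. fin_scale (\<beta> $$ (j, i)) (munit k i))"
proof (rule fin_mat_eqI)
  fix p q
  have "entry (\<Sum>i<s. fin_scale (\<beta> $$ (j, i)) (munit k i)) p q
      = (\<Sum>i<s. if i = q then (if p = k then \<beta> $$ (j, q) else 0) else 0)"
    unfolding entry_sum by (intro sum.cong) auto
  then show "entry (munit k j * fin_of_mat \<beta>) p q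
      = entry (\<Sum>i<s. fin_scale (\<beta> $$ (j, i)) (munit k i)) p q"
    using assms by (simp add: entry_munit_mult entry_fin_of_mat sum.delta)
qed

lemma fin_adj_fin_of_mat: "fin_adj (fin_of_mat \<alpha>) = fin_of_mat (adj_mat cnj \<alpha>)"
  by (rule fin_mat_eqI) (auto simp: entry_fin_of_mat adj_mat_def)

lemma mats_iff: "A \<in> mats V m n \<longleftrightarrow> A \<in> carrier_mat m n \<and> (\<forall>i<m. \<forall>j<n. A $$ (i, j) \<in> V)"
  unfolding mats_def elements_mat_def by force

lemma index_dsum:
  assumes "v \<in> carrier_mat m n" "w \<in> carrier_mat r s" "i < m + r" "j < n + s"
  shows "dsum v w $$ (i, j) = (if i < m then if j < n then v $$ (i, j) else 0
    else if j < n then 0 else w $$ (i - m, j - n))"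
  using assms by (simp add: dsum_def)

lemma dsum_carrier: "v \<in> carrier_mat m n \<Longrightarrow> w \<in> carrier_mat r s \<Longrightarrow> dsum v w \<in> carrier_mat (m + r) (n + s)"
  by (auto simp: dsum_def)

section \<open>Bimodules\<close>

context F_bimodule
begin

lemma lact_zero [simp]: "a \<rhd> 0 = 0"
  using lact_add[of a 0 0] by simp

lemma zero_ract [simp]: "0 \<lhd> a = 0"
  using add_ract[of 0 0 a] by simp

lemma zero_lact [simp]: "0 \<rhd> v = 0"
  using add_lact[of 0 0 v] by simp

lemma ract_zero [simp]: "v \<lhd> 0 = 0"
  using ract_add[of v 0 0] by simp

lemma lact_minus [simp]: "a \<rhd> (- v) = - (a \<rhd> v)"
  using lact_add[of a v "- v"] by (simp add: eq_neg_iff_add_eq_0 add.commute)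

lemma minus_lact [simp]: "(- a) \<rhd> v = - (a \<rhd> v)"
  using add_lact[of a "- a" v] by (simp add: eq_neg_iff_add_eq_0 add.commute)

lemma minus_ract [simp]: "(- v) \<lhd> a = - (v \<lhd> a)"
  using add_ract[of v "- v" a] by (simp add: eq_neg_iff_add_eq_0 add.commute)

lemma ract_minus [simp]: "v \<lhd> (- a) = - (v \<lhd> a)"
  using ract_add[of v a "- a"] by (simp add: eq_neg_iff_add_eq_0 add.commute)

lemma lact_diff: "a \<rhd> (u - v) = a \<rhd> u - a \<rhd> v"
  using lact_add[of a u "- v"] by simp

lemma diff_lact: "(a - b) \<rhd> v = a \<rhd> v - b \<rhd> v"
  using add_lact[of a "- b" v] by simp

lemma diff_ract: "(u - v) \<lhd> a = (u \<lhd> a) - (v \<lhd> a)"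
  using add_ract[of u "- v" a] by simp

lemma ract_diff: "v \<lhd> (a - b) = (v \<lhd> a) - (v \<lhd> b)"
  using ract_add[of v a "- b"] by simp

lemma lact_sum: "a \<rhd> (\<Sum>x\<in>S. f x) = (\<Sum>x\<in>S. a \<rhd> f x)"
  by (induction S rule: infinite_finite_induct) (auto simp: lact_add)

lemma sum_lact: "(\<Sum>x\<in>S. f x) \<rhd> v = (\<Sum>x\<in>S. f x \<rhd> v)"
  by (induction S rule: infinite_finite_induct) (auto simp: add_lact)

lemma sum_ract: "(\<Sum>x\<in>S. f x) \<lhd> a = (\<Sum>x\<in>S. f x \<lhd> a)"
  by (induction S rule: infinite_finite_induct) (auto simp: add_ract)

lemma ract_sum: "v \<lhd> (\<Sum>x\<in>S. f x) = (\<Sum>x\<in>S. v \<lhd> f x)"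
  by (induction S rule: infinite_finite_induct) (auto simp: ract_add)

lemmas act_collect = lact_ract mult_lact[symmetric] ract_mult[symmetric]

definition block :: "nat \<Rightarrow> nat \<Rightarrow> 'v \<Rightarrow> bool" where
  "block m n v \<longleftrightarrow> Iunit m \<rhd> v \<lhd> Iunit n = v"

lemma supported_block: "supported n v \<longleftrightarrow> block n n v"
  by (simp add: supported_def block_def)

lemma block_lact: "block m n v \<Longrightarrow> Iunit m \<rhd> v = v"
  unfolding block_def by (metis Iunit_mult_Iunit lact_ract min.idem mult_lact)

lemma block_ract: "block m n v \<Longrightarrow> v \<lhd> Iunit n = v"
  unfolding block_def by (metis Iunit_mult_Iunit min.idem ract_mult)

lemma blockI: "Iunit m \<rhd> v = v \<Longrightarrow> v \<lhd> Iunit n = v \<Longrightarrow> block m n v"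
  by (simp add: block_def)

lemma block_mono:
  assumes "block m n v" "m \<le> m'" "n \<le> n'"
  shows "block m' n' v"
proof (rule blockI)
  show "Iunit m' \<rhd> v = v"
    using mult_lact[of "Iunit m'" "Iunit m" v] block_lact[OF assms(1)] assms(2)
    by (simp add: min_absorb2)
  show "v \<lhd> Iunit n' = v"
    using ract_mult[of v "Iunit n" "Iunit n'"] block_ract[OF assms(1)] assms(3)
    by (simp add: min_absorb1)
qed

lemma block_add: "block m n u \<Longrightarrow> block m n v \<Longrightarrow> block m n (u + v)"
  by (simp add: block_def lact_add add_ract)

lemma block_diff: "block m n u \<Longrightarrow> block m n v \<Longrightarrow> block m n (u - v)"
  by (simp add: block_def lact_diff diff_ract)

lemma block_zero [simp]: "block m n 0"
  by (simp add: block_def)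

lemma corner_eq: "corner n = {v. block n n v}"
proof -
  have "block n n (Iunit n \<rhd> v \<lhd> Iunit n)" for v by (simp add: block_def act_collect)
  then show ?thesis unfolding corner_def block_def by (auto intro: range_eqI sym)
qed

end

section \<open>Local units and the derived complex scalars\<close>

context nondegenerate_F_bimodule
begin

lemma ord_ge_1: "1 \<le> ord v" and block_ord: "block (ord v) (ord v) v"
proof -
  from nondegenerate[of v] obtain n where "1 \<le> n \<and> supported n v" by blast
  then have "1 \<le> ord v \<and> supported (ord v) v" unfolding ord_def by (rule LeastI)
  then show "1 \<le> ord v" "block (ord v) (ord v) v" by (auto simp: supported_block)
qed

lemma ord_le: "1 \<le> n \<Longrightarrow> block n n v \<Longrightarrow> ord v \<le> n"
  unfolding ord_def by (rule Least_le) (simp add: supported_block)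

lemma cscale_left: "block n n v \<Longrightarrow> 1 \<le> n \<Longrightarrow> cscale \<alpha> v = fin_scale \<alpha> (Iunit n) \<rhd> v"
  by (simp add: cscale_eq supported_block)

text \<open>This is \<open>scale_balanced\<close> with \<open>Iunit n\<close>, which fixes
  \<open>v\<close>, on both sides. All rules for scalars on the right, and the conjugate-linearity
  of \<open>star\<close>, rest on it.\<close>

lemma cscale_right:
  assumes "block n n v" "1 \<le> n"
  shows "cscale \<alpha> v = v \<lhd> fin_scale \<alpha> (Iunit n)"
proof -
  have "cscale \<alpha> v = fin_scale \<alpha> (Iunit n) \<rhd> v \<lhd> Iunit n"
    using assms by (simp add: cscale_left block_ract lact_ract[symmetric])
  also have "\<dots> = v \<lhd> fin_scale \<alpha> (Iunit n)"
    using assms by (simp add: scale_balanced block_lact)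
  finally show ?thesis .
qed

lemma common_block2: obtains n where "1 \<le> n" "block n n u" "block n n v"
proof
  let ?n = "max (ord u) (ord v)"
  show "1 \<le> ?n" using ord_ge_1[of u] by simp
  show "block ?n ?n u" "block ?n ?n v" by (rule block_mono[OF block_ord]; simp)+
qed

text \<open>\<open>cscale\<close> is defined through the order of each single element. One truncated
  identity that is a unit for \<open>v\<close> and for \<open>a\<close> lets scalars of different
  elements be unfolded at the same size.\<close>

lemma common_block_act:
  obtains n where "1 \<le> n" "block n n v" "Iunit n * a = a" "a * Iunit n = a"
proof -
  obtain N where N: "\<forall>i\<ge>N. \<forall>j. entry a i j = 0 \<and> entry a j i = 0"
    using entries_vanish_beyond by blast
  let ?n = "max (ord v) N"
  show ?thesis
  proof (rule that)
    show "1 \<le> ?n" using ord_ge_1[of v] by simp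
    show "block ?n ?n v" by (rule block_mono[OF block_ord]) auto
    show "Iunit ?n * a = a" "a * Iunit ?n = a"
      using N by (auto intro!: fin_mat_eqI simp: entry_Iunit_mult entry_mult_Iunit)
  qed
qed

lemma cscale_lact: "cscale \<alpha> (a \<rhd> v) = fin_scale \<alpha> a \<rhd> v"
proof -
  obtain n where n: "1 \<le> n" "block n n v" "Iunit n * a = a" "a * Iunit n = a"
    by (rule common_block_act)
  have "block n n (a \<rhd> v)"
    using n by (intro blockI) (simp_all add: mult_lact[symmetric] lact_ract[symmetric] block_ract)
  from cscale_left[OF this n(1)] show ?thesis
    using n by (simp add: mult_lact[symmetric] fin_scale_mult_left)
qed

lemma lact_cscale: "a \<rhd> cscale \<alpha> v = fin_scale \<alpha> a \<rhd> v"
proof -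
  obtain n where n: "1 \<le> n" "block n n v" "Iunit n * a = a" "a * Iunit n = a"
    by (rule common_block_act)
  then show ?thesis
    by (simp add: cscale_left mult_lact[symmetric] fin_scale_mult_right)
qed

lemma cscale_ract: "cscale \<alpha> (v \<lhd> a) = cscale \<alpha> v \<lhd> a"
proof -
  obtain n where n: "1 \<le> n" "block n n v" "Iunit n * a = a" "a * Iunit n = a"
    by (rule common_block_act)
  have "block n n (v \<lhd> a)"
    using n by (intro blockI) (simp_all add: ract_mult[symmetric] lact_ract block_lact)
  from cscale_left[OF this n(1)] show ?thesis
    using n by (simp add: cscale_left lact_ract)
qed

lemma ract_scale: "v \<lhd> fin_scale \<alpha> a = cscale \<alpha> v \<lhd> a"
proof -
  obtain n where n: "1 \<le> n" "block n n v" "Iunit n * a = a" "a * Iunit n = a"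
    by (rule common_block_act)
  then show ?thesis
    by (simp add: cscale_right ract_mult[symmetric] fin_scale_mult_left)
qed

lemma cscale_add_right: "cscale \<alpha> (u + v) = cscale \<alpha> u + cscale \<alpha> v"
proof -
  obtain n where n: "1 \<le> n" "block n n u" "block n n v" by (rule common_block2)
  then show ?thesis
    by (simp add: cscale_left[OF block_add[OF n(2,3)] n(1)] cscale_left[of n] lact_add)
qed

lemma cscale_add_left: "cscale (\<alpha> + \<beta>) v = cscale \<alpha> v + cscale \<beta> v"
  by (simp add: cscale_left[OF block_ord ord_ge_1] fin_scale_add add_lact)

lemma cscale_cscale: "cscale \<alpha> (cscale \<beta> v) = cscale (\<alpha> * \<beta>) v"
  by (simp add: cscale_left[OF block_ord ord_ge_1, of _ v] cscale_lact fin_scale_scale)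

lemma cscale_1 [simp]: "cscale 1 v = v"
  by (simp add: cscale_left[OF block_ord ord_ge_1] block_lact[OF block_ord])

lemma cscale_0 [simp]: "cscale 0 v = 0"
  by (simp add: cscale_left[OF block_ord ord_ge_1])

lemma cscale_zero [simp]: "cscale \<alpha> 0 = 0"
  using cscale_add_right[of \<alpha> 0 0] by simp

lemma cscale_minus_left: "cscale (- \<alpha>) v = - cscale \<alpha> v"
  using cscale_add_left[of \<alpha> "- \<alpha>" v] by (simp add: eq_neg_iff_add_eq_0 add.commute)

lemma cscale_minus_right: "cscale \<alpha> (- v) = - cscale \<alpha> v"
  using cscale_add_right[of \<alpha> v "- v"] by (simp add: eq_neg_iff_add_eq_0 add.commute)

lemma cscale_minus1 [simp]: "cscale (- 1) v = - v"
  by (simp add: cscale_minus_left)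

lemma cscale_diff_right: "cscale \<alpha> (u - v) = cscale \<alpha> u - cscale \<alpha> v"
  using cscale_add_right[of \<alpha> u "- v"] by (simp add: cscale_minus_right)

lemma cscale_sum_right: "cscale \<alpha> (\<Sum>x\<in>S. f x) = (\<Sum>x\<in>S. cscale \<alpha> (f x))"
  by (induction S rule: infinite_finite_induct) (auto simp: cscale_add_right)

lemma block_cscale: "block m n v \<Longrightarrow> block m n (cscale \<alpha> v)"
  unfolding block_def lact_cscale by (simp add: cscale_lact[symmetric] cscale_ract[symmetric])

end

context star_F_bimodule
begin

lemma star_zero [simp]: "star 0 = 0"
  using star_add[of 0 0] by simp

lemma star_minus: "star (- v) = - star v"
  using star_add[of v "- v"] by (simp add: eq_neg_iff_add_eq_0 add.commute)

lemma star_diff: "star (u - v) = star u - star v"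
  using star_add[of u "- v"] by (simp add: star_minus)

lemma star_sum: "star (\<Sum>x\<in>S. f x) = (\<Sum>x\<in>S. star (f x))"
  by (induction S rule: infinite_finite_induct) (auto simp: star_add)

lemma star_act: "star (a \<rhd> v \<lhd> b) = fin_adj b \<rhd> star v \<lhd> fin_adj a"
  by (simp add: star_lact star_ract lact_ract)

lemma block_star: "block m n v \<Longrightarrow> block n m (star v)"
  unfolding block_def by (metis fin_adj_Iunit star_act)

end

section \<open>Absolute values in the bimodule\<close>

context nondegenerate_absolutely_ordered_F_bimodule
begin

lemma star_cscale: "star (cscale \<alpha> v) = cscale (cnj \<alpha>) (star v)"
proof -
  let ?n = "ord v"
  have b: "block ?n ?n v" "block ?n ?n (star v)" by (auto intro: block_ord block_star)
  have "star (cscale \<alpha> v) = star v \<lhd> fin_scale (cnj \<alpha>) (Iunit ?n)"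
    using b ord_ge_1 by (simp add: cscale_left star_lact fin_adj_scale)
  also have "\<dots> = cscale (cnj \<alpha>) (star v)"
    using cscale_right[OF b(2) ord_ge_1] by simp
  finally show ?thesis .
qed

text \<open>The cone axioms by themselves admit an empty cone. \<open>absv\<close> provides some
  element of \<open>P\<close>, here its value at the arbitrary point \<open>undefined\<close>, and
  compressing it by 0 gives 0.\<close>

lemma P_zero: "0 \<in> P"
  using P_conj[OF absv_P, of 0 undefined] by simp

text \<open>Scaling by r is compression by sqrt r times a local unit.\<close>

lemma P_scale:
  assumes "v \<in> P" "0 \<le> r"
  shows "cscale (of_real r) v \<in> P"
proof -
  let ?n = "ord v" and ?a = "fin_scale (of_real (sqrt r)) (Iunit (ord v))"
  have "fin_adj ?a \<rhd> v \<lhd> ?a = cscale (of_real r) v"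
    using assms(2)
    by (simp add: fin_adj_scale ract_scale cscale_lact fin_scale_scale
        cscale_ract[symmetric] of_real_mult[symmetric] del: of_real_mult)
      (simp add: cscale_left[OF block_ord ord_ge_1] lact_ract[symmetric] block_ract[OF block_ord])
  then show ?thesis using P_conj[OF assms(1), of ?a] by simp
qed

lemma le_trans: "u \<preceq> v \<Longrightarrow> v \<preceq> w \<Longrightarrow> u \<preceq> w"
  using P_add[of "v - u" "w - v"] by (simp add: le_def)

lemma half_double: "cscale (of_real (1/2)) (v + v) = v"
proof -
  have "cscale (of_real (1/2)) (v + v) = cscale (of_real (1/2) + of_real (1/2)) v"
    by (simp only: cscale_add_right cscale_add_left)
  also have "(of_real (1/2) + of_real (1/2) :: complex) = 1" by simp
  finally show ?thesis by simp
qed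

text \<open>If \<open>w\<close> and \<open>- w\<close> are positive, then \<open>0 \<le> w \<le> 0\<close>, so the axiom for elements below the
  second part of an orthogonal pair, applied to the pair \<open>(0, 0)\<close>, yields \<open>|- w| = w\<close>.\<close>

lemma P_proper:
  assumes "w \<in> P" "- w \<in> P"
  shows "w = 0"
proof -
  have "absv (0 - w) = 0 + w"
    using absv_hered[of 0 0 w] assms P_zero absv_pos[OF P_zero] by (simp add: le_def)
  then have "w + w = - w + w" using absv_pos[OF assms(2)] by simp
  then show ?thesis using half_double[of w] by simp
qed

lemma le_antisym: "u \<preceq> v \<Longrightarrow> v \<preceq> u \<Longrightarrow> u = v"
  using P_proper[of "u - v"] by (simp add: le_def)

lemma le_conj: "u \<preceq> v \<Longrightarrow> fin_adj a \<rhd> u \<lhd> a \<preceq> fin_adj a \<rhd> v \<lhd> a"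
  using P_conj[of "v - u" a] by (simp add: le_def lact_diff diff_ract)

lemma cscale_le_mono:
  assumes "r \<le> s" "v \<in> P"
  shows "cscale (of_real r) v \<preceq> cscale (of_real s) v"
  using P_scale[OF assms(2), of "s - r"] assms(1) cscale_add_left[of "of_real s" "- of_real r" v]
  by (simp add: le_def cscale_minus_left)

section \<open>Consequences of the contraction axiom\<close>

lemma absv_absv: "absv (absv v) = absv v"
  by (simp add: absv_pos absv_P)

lemma absv_zero [simp]: "absv 0 = 0"
  by (simp add: absv_pos P_zero)

text \<open>Since a larger scalar gives a larger multiple of a positive element, operator norms only
  ever have to be estimated from above.\<close>

lemma absv_act_le:
  assumes "fin_norm a \<le> c"
  shows "absv (a \<rhd> v \<lhd> b) \<preceq> cscale (of_real c) (absv (absv v \<lhd> b))"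
  by (rule le_trans[OF absv_conj cscale_le_mono[OF assms absv_P]])

lemma absv_act_le_contraction: "fin_norm a \<le> 1 \<Longrightarrow> absv (a \<rhd> v \<lhd> b) \<preceq> absv (absv v \<lhd> b)"
  using absv_act_le[of a 1] by simp

lemma block_absv: "1 \<le> n \<Longrightarrow> block n n v \<Longrightarrow> block n n (absv v)"
  by (rule block_mono[OF block_ord]) (use ord_absv ord_le le_trans in \<open>meson order_trans\<close>)+

lemma common_block_absv: obtains n where "1 \<le> n" "block n n v" "block n n (absv v)"
  using block_absv block_ord ord_ge_1 by blast

text \<open>The contraction axiom with a local unit on the right that fixes both \<open>v\<close>
  and \<open>absv v\<close>; the same device on the left gives \<open>absv_ract_le\<close>.\<close>

lemma absv_lact_le:
  assumes "fin_norm a \<le> c"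
  shows "absv (a \<rhd> v) \<preceq> cscale (of_real c) (absv v)"
proof -
  obtain n where n: "1 \<le> n" "block n n v" "block n n (absv v)" by (rule common_block_absv)
  show ?thesis
    using absv_act_le[OF assms, of v "Iunit n"] n
    by (simp add: lact_ract[symmetric] block_ract absv_absv)
qed

lemma absv_ract_le: "absv (v \<lhd> b) \<preceq> absv (absv v \<lhd> b)"
proof -
  obtain n where n: "1 \<le> n" "block n n v" "block n n (absv v)" by (rule common_block_absv)
  show ?thesis
    using absv_act_le_contraction[OF fin_norm_Iunit[of n], of v b] n by (simp add: block_lact)
qed

text \<open>Left multiplication by a contraction does not increase the absolute value, and
  \<open>fin_adj u\<close> undoes \<open>u\<close> on \<open>v\<close>; hence both
  inequalities.\<close>

lemma absv_partial_isometry_left: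
  assumes "fin_norm u \<le> 1" "fin_norm (fin_adj u) \<le> 1" "(fin_adj u * u) \<rhd> v = v"
  shows "absv (u \<rhd> v) = absv v"
proof (rule le_antisym)
  show "absv (u \<rhd> v) \<preceq> absv v" using absv_lact_le[OF assms(1), of v] by simp
  show "absv v \<preceq> absv (u \<rhd> v)"
    using absv_lact_le[OF assms(2), of "u \<rhd> v"] assms(3) by (simp add: mult_lact)
qed

text \<open>By the last assumption \<open>w \<lhd> b\<close> is \<open>b\<close> acting from the
  left on the positive element \<open>fin_adj b \<rhd> w \<lhd> b\<close>, and \<open>b\<close> is
  isometric there. With \<open>w = absv v\<close> this evaluates the right-hand side of
  \<open>absv_ract_le\<close>.\<close>

lemma absv_P_ract:
  assumes "w \<in> P" "fin_norm b \<le> 1" "fin_norm (fin_adj b) \<le> 1" "(b * fin_adj b) \<rhd> w = w"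
  shows "absv (w \<lhd> b) = fin_adj b \<rhd> w \<lhd> b"
proof -
  have "absv (w \<lhd> b) = absv (b \<rhd> (fin_adj b \<rhd> w \<lhd> b))"
    using assms(4) by (simp add: act_collect)
  also have "\<dots> = absv (fin_adj b \<rhd> w \<lhd> b)"
  proof (rule absv_partial_isometry_left[OF assms(2,3)])
    have "(fin_adj b * b) \<rhd> (fin_adj b \<rhd> w \<lhd> b) = fin_adj b \<rhd> ((b * fin_adj b) \<rhd> w) \<lhd> b"
      by (simp add: act_collect mult.assoc)
    then show "(fin_adj b * b) \<rhd> (fin_adj b \<rhd> w \<lhd> b) = fin_adj b \<rhd> w \<lhd> b"
      by (simp only: assms(4))
  qed
  also have "\<dots> = fin_adj b \<rhd> w \<lhd> b" by (rule absv_pos[OF P_conj[OF assms(1)]])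
  finally show ?thesis .
qed

text \<open>With the symmetry \<open>d = 2e - 1\<close> (truncated to a large corner) one has \<open>v d = v\<close>, hence
  \<open>|v| = d |v| d\<close> is block diagonal with respect to \<open>e\<close>; then \<open>|v| \<le> ||v| e| = e |v| e\<close> kills the
  complementary block.\<close>

lemma absv_dproj:
  assumes "finite A" "v \<lhd> dproj A = v"
  shows "dproj A \<rhd> absv v \<lhd> dproj A = absv v" "dproj A \<rhd> absv v = absv v"
    "absv v \<lhd> dproj A = absv v"
proof -
  let ?e = "dproj A" and ?w = "absv v"
  obtain k where k: "A \<subseteq> {..<k}" using assms(1) unfolding finite_nat_set_iff_bounded by blast
  obtain n0 where n0: "1 \<le> n0" "block n0 n0 v" "block n0 n0 ?w" by (rule common_block_absv)
  define n where "n = max n0 k"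
  have n: "block n n v" "block n n ?w" and An: "A \<subseteq> {..<n}"
    using n0(2,3) k by (auto simp: n_def intro: block_mono)
  define d where "d = fin_scale 2 ?e - Iunit n"
  have entry_d: "entry d i j = (if i = j \<and> i < n then (if i \<in> A then 1 else - 1) else 0)" for i j
    using An by (auto simp: d_def entry_dproj assms(1) entry_Iunit)
  have adj_d: "fin_adj d = d" by (rule fin_mat_eqI) (simp add: entry_d)
  have dd: "d * d = Iunit n"
  proof (rule fin_mat_eqI)
    fix i j show "entry (d * d) i j = entry (Iunit n) i j"
      by (subst entry_times_monomial[of _ _ i]) (auto simp: entry_d entry_Iunit split: if_splits)
  qed
  have norm_d: "fin_norm d \<le> 1"
    by (rule fin_norm_le_monomial[of "\<lambda>i. i" UNIV]) (auto simp: entry_d split: if_splits)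
  have two: "cscale 2 x = x + x" for x
    using cscale_add_left[of 1 1 x] by simp
  have e_ract: "x \<lhd> d = (x \<lhd> ?e) + (x \<lhd> ?e) - x" if "block n n x" for x
    using block_ract[OF that] by (simp add: d_def ract_diff ract_scale two add_ract)
  have e_lact: "d \<rhd> x = ?e \<rhd> x + ?e \<rhd> x - x" if "block n n x" for x
    using block_lact[OF that]
    by (simp add: d_def diff_lact cscale_lact[symmetric] two)
  have vd: "v \<lhd> d = v" using e_ract[OF n(1)] assms(2) by simp
  have wd: "absv (?w \<lhd> d) = d \<rhd> ?w \<lhd> d"
    using absv_P_ract[OF absv_P norm_d, of v] norm_d n(2) by (simp add: adj_d dd block_lact)
  have le: "?w \<preceq> d \<rhd> ?w \<lhd> d"
    using absv_ract_le[of v d] by (simp add: vd wd)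
  \<comment> \<open>Conjugating by \<open>d\<close> once more reverses the inequality, since
    \<open>d * d\<close> acts as the identity on \<open>?w\<close>.\<close>
  have "d \<rhd> ?w \<lhd> d \<preceq> d \<rhd> (d \<rhd> ?w \<lhd> d) \<lhd> d"
    using le_conj[OF le, of d] by (simp add: adj_d)
  then have "d \<rhd> ?w \<lhd> d \<preceq> ?w"
    using n(2) by (simp add: act_collect dd block_lact block_ract)
  from le_antisym[OF le this] have "d \<rhd> ?w = (d \<rhd> (d \<rhd> ?w)) \<lhd> d" by (metis lact_ract)
  also have "\<dots> = ?w \<lhd> d" using n(2) by (simp add: mult_lact[symmetric] dd block_lact)
  finally have "?e \<rhd> ?w + ?e \<rhd> ?w = (?w \<lhd> ?e) + (?w \<lhd> ?e)"
    using e_ract[OF n(2)] e_lact[OF n(2)] by simp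
  then have comm: "?e \<rhd> ?w = ?w \<lhd> ?e" by (metis half_double)
  have ee: "?e * ?e = ?e" by (simp add: dproj_mult_dproj assms(1))
  have eI: "?e * Iunit n = ?e"
    using An by (simp add: Iunit_eq_dproj dproj_mult_dproj assms(1) Int_absorb2)
  have ewe: "?w \<lhd> ?e = ?e \<rhd> ?w \<lhd> ?e"
    using comm by (simp add: ract_mult[symmetric] ee)
  let ?f = "Iunit n - ?e"
  have adj_e: "fin_adj ?e = ?e" by (rule fin_adj_dproj[OF assms(1)])
  \<comment> \<open>\<open>?f\<close> is the complementary projection inside the large corner. As
    \<open>?e\<close> commutes with \<open>?w\<close>, this compression equals
    \<open>?w - (?w \<lhd> ?e)\<close>, which bounds \<open>?w \<lhd> ?e\<close> by
    \<open>?w\<close>; the contraction axiom gives the opposite inequality.\<close>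
  have "?f \<rhd> ?w \<lhd> ?f \<in> P"
    using P_conj[OF absv_P, of ?f v] by (simp add: fin_adj_diff adj_e)
  also have "?f \<rhd> ?w \<lhd> ?f = ?w - (?w \<lhd> ?e)"
    using block_lact[OF n(2)] block_ract[OF n(2)]
    by (simp add: diff_lact ract_diff diff_ract comm ract_mult[symmetric] ee eI)
  finally have pos: "?w - (?w \<lhd> ?e) \<in> P" .
  have "?w \<lhd> ?e \<in> P" using P_conj[OF absv_P, of ?e v] ewe by (simp add: adj_e)
  then have "?w \<preceq> ?w \<lhd> ?e"
    using absv_ract_le[of v ?e] assms(2) by (simp add: absv_pos)
  then have "?w = ?w \<lhd> ?e" by (rule le_antisym) (simp add: le_def pos)
  then show "?w \<lhd> ?e = ?w" by simp
  then show "?e \<rhd> ?w = ?w" using comm by simp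
  then show "?e \<rhd> ?w \<lhd> ?e = ?w" using \<open>?w \<lhd> ?e = ?w\<close> by simp
qed

lemma block_absv_cols: "block m n v \<Longrightarrow> block n n (absv v)"
  using absv_dproj[of "{..<n}" v] by (simp add: Iunit_eq_dproj[symmetric] block_ract block_def)

text \<open>One inequality is \<open>absv_ract_le\<close> for \<open>v\<close> and \<open>b\<close>;
  the other is the same for \<open>v \<lhd> b\<close> and \<open>fin_adj b\<close>, conjugated back
  by \<open>b\<close>. In both cases \<open>absv_dproj\<close> supplies the support that
  \<open>absv_P_ract\<close> requires.\<close>

lemma absv_partial_isometry_right:
  assumes "finite A" "inj_on f A" "v \<lhd> dproj A = v"
  defines "b \<equiv> fin_adj (pinj A f)"
  shows "absv (v \<lhd> b) = fin_adj b \<rhd> absv v \<lhd> b"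
proof (rule le_antisym)
  have nb: "fin_norm b \<le> 1" "fin_norm (fin_adj b) \<le> 1"
    using assms by (simp_all add: fin_norm_adj_pinj fin_norm_pinj)
  have bb: "b * fin_adj b = dproj A" "fin_adj b * b = dproj (f ` A)"
    using assms by (simp_all add: adj_pinj_mult_pinj pinj_mult_adj_pinj)
  note w = absv_dproj[OF assms(1,3)]
  show "absv (v \<lhd> b) \<preceq> fin_adj b \<rhd> absv v \<lhd> b"
    using absv_ract_le[of v b] absv_P_ract[OF absv_P nb, of v] by (simp add: bb w)
  have "v \<lhd> b \<lhd> dproj (f ` A) = v \<lhd> (b * fin_adj b) \<lhd> b"
    by (simp add: bb(2)[symmetric] ract_mult[symmetric] mult.assoc)
  then have vb: "v \<lhd> b \<lhd> dproj (f ` A) = v \<lhd> b" by (simp add: bb assms(3))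
  note w' = absv_dproj[OF finite_imageI[OF assms(1)] vb]
  have "absv v = absv (v \<lhd> b \<lhd> fin_adj b)"
    by (simp add: ract_mult[symmetric] bb assms(3))
  also have "absv (v \<lhd> b \<lhd> fin_adj b) \<preceq> b \<rhd> absv (v \<lhd> b) \<lhd> fin_adj b"
    using absv_ract_le[of "v \<lhd> b" "fin_adj b"] absv_P_ract[OF absv_P nb(2), of "v \<lhd> b"] nb(1)
    by (simp add: bb w')
  finally have "fin_adj b \<rhd> absv v \<lhd> b \<preceq> fin_adj b \<rhd> (b \<rhd> absv (v \<lhd> b) \<lhd> fin_adj b) \<lhd> b"
    by (rule le_conj)
  then show "fin_adj b \<rhd> absv v \<lhd> b \<preceq> absv (v \<lhd> b)"
    by (simp add: act_collect bb w')
qed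

text \<open>The contraction axiom gives one inequality; applied to \<open>inverse \<alpha>\<close>
  and the scaled element it gives the other.\<close>

lemma absv_cscale: "absv (cscale \<alpha> v) = cscale (of_real (cmod \<alpha>)) (absv v)"
proof (cases "\<alpha> = 0")
  case False
  have le: "absv (cscale \<beta> x) \<preceq> cscale (of_real (cmod \<beta>)) (absv x)" for \<beta> x
    using absv_lact_le[OF fin_norm_scale_Iunit[of \<beta> "ord x"], of x]
    by (simp add: cscale_left[OF block_ord ord_ge_1, of \<beta> x])
  have "cscale (of_real (cmod \<alpha>)) (absv v) \<preceq> absv (cscale \<alpha> v)"
  proof -
    have "absv v \<preceq> cscale (of_real (cmod (inverse \<alpha>))) (absv (cscale \<alpha> v))"
      using le[of "inverse \<alpha>" "cscale \<alpha> v"] False by (simp add: cscale_cscale)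
    then have "cscale (of_real (cmod (inverse \<alpha>))) (absv (cscale \<alpha> v)) - absv v \<in> P"
      by (simp add: le_def)
    from P_scale[OF this, of "cmod \<alpha>"] show ?thesis
      using False by (simp add: cscale_diff_right cscale_cscale le_def norm_inverse
          of_real_mult[symmetric] del: of_real_mult)
  qed
  with le show ?thesis by (intro le_antisym)
qed simp

lemma absv_star_bound:
  assumes "star v = v"
  shows "absv v + v \<in> P" "absv v - v \<in> P"
proof -
  let ?n = "ord v" and ?I = "Iunit (ord v)" and ?J = "Junit (ord v)"
  have JI: "?J * ?I = 0"
  proof (rule fin_mat_eqI)
    fix i j show "entry (?J * ?I) i j = entry 0 i j" by (simp add: entry_mult_Iunit entry_Junit)
  qed
  have IJ': "?I * fin_adj ?J = 0"
    using JI by (metis fin_adj_Iunit fin_adj_mult fin_adj_adj fin_scale_0 fin_adj_scale complex_cnj_zero)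
  have JJ': "?J * fin_adj ?J = ?I"
  proof (rule fin_mat_eqI)
    fix i j show "entry (?J * fin_adj ?J) i j = entry ?I i j"
      by (subst entry_times_monomial[of _ _ "?n + i"])
         (auto simp: entry_Junit entry_Iunit split: if_splits)
  qed
  have b: "block ?n ?n v" "block ?n ?n (absv v)"
    using block_absv block_ord ord_ge_1 by auto
  have fix_l: "?I \<rhd> x = x" and fix_r: "x \<lhd> ?I = x" if "x = v \<or> x = absv v" for x
    using that b block_lact block_ract by blast+
  have J0: "?J \<rhd> x = 0" "x \<lhd> fin_adj ?J = 0" if "x = v \<or> x = absv v" for x
    using fix_l[OF that] fix_r[OF that] mult_lact[of ?J ?I x] ract_mult[of x ?I "fin_adj ?J"]
    by (simp_all add: JI IJ')
  have II: "?I * ?I = ?I" by simp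
  \<comment> \<open>As \<open>v\<close> is self-adjoint, this is the 2 x 2 block matrix with |v| on
    the diagonal and v off it. Compression by \<open>?I + fin_scale c (fin_adj ?J)\<close> adds the
    four blocks, the off-diagonal ones with sign c, and yields |v| + c v twice because c * c =
    1.\<close>
  let ?S = "pair ?n (absv v) (absv v) + sa star ?n v"
  have S: "?S \<in> P" using absv_pair[of v] assms by simp
  have eq: "fin_adj (?I + fin_scale c (fin_adj ?J)) \<rhd> ?S \<lhd> (?I + fin_scale c (fin_adj ?J))
      = (absv v + cscale c v) + (absv v + cscale c v)" if c: "c = 1 \<or> c = - 1" for c
  proof -
    have adj: "fin_adj (?I + fin_scale c (fin_adj ?J)) = ?I + fin_scale c ?J"
      using c by (auto simp: fin_adj_add fin_adj_scale)
    have l: "(?I + fin_scale c ?J) \<rhd> ?S = absv v + (v \<lhd> ?J) + cscale c (absv v \<lhd> ?J) + cscale c v"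
    proof -
      have 1: "?I \<rhd> ?S = absv v + (v \<lhd> ?J)"
        by (simp add: pair_def sa_def assms lact_add lact_ract mult_lact[symmetric] IJ' fix_l fix_r)
      have 2: "?J \<rhd> ?S = (absv v \<lhd> ?J) + v"
        by (simp add: pair_def sa_def assms lact_add lact_ract mult_lact[symmetric] JI JJ' J0 fix_l fix_r)
      show ?thesis
        unfolding add_lact cscale_lact[symmetric] 1 2 by (simp add: cscale_add_right)
    qed
    have r: "(absv v + (v \<lhd> ?J) + cscale c (absv v \<lhd> ?J) + cscale c v) \<lhd> ?I = absv v + cscale c v"
      by (simp add: add_ract cscale_ract[symmetric] ract_mult[symmetric] JI fix_r)
    have r2: "(absv v + (v \<lhd> ?J) + cscale c (absv v \<lhd> ?J) + cscale c v) \<lhd> fin_adj ?J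
      = v + cscale c (absv v)"
      by (simp add: add_ract cscale_ract[symmetric] ract_mult[symmetric] JJ' fix_r J0)
    show ?thesis
      unfolding adj l ract_add r ract_scale cscale_ract[symmetric] r2
      using c by (auto simp: cscale_add_right)
  qed
  have half: "x + x \<in> P \<Longrightarrow> x \<in> P" for x
    using P_scale[of "x + x" "1/2"] half_double[of x] by simp
  have "absv v + cscale c v \<in> P" if "c = 1 \<or> c = - 1" for c
    using P_conj[OF S, of "?I + fin_scale c (fin_adj ?J)"] half unfolding eq[OF that] by blast
  from this[of 1] this[of "- 1"] show "absv v + v \<in> P" "absv v - v \<in> P" by auto
qed

end

section \<open>Matrices over the corner\<close>

declare One_nat_def [simp del]

context F_bimodule
begin

definition rect_T :: "nat \<Rightarrow> nat \<Rightarrow> 'v mat \<Rightarrow> 'v" where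
  "rect_T m n A = (\<Sum>i<m. \<Sum>j<n. munit i 0 \<rhd> A $$ (i, j) \<lhd> munit 0 j)"

text \<open>The inverse of \<open>rect_T\<close>: matrix units transport each entry of the block
  into the first corner.\<close>

definition coords :: "nat \<Rightarrow> nat \<Rightarrow> 'v \<Rightarrow> 'v mat" where
  "coords m n x = mat m n (\<lambda>(i, j). munit 0 i \<rhd> x \<lhd> munit j 0)"

lemma T_eq_rect_T: "T n = rect_T n n"
  by (simp add: fun_eq_iff T_def rect_T_def)

lemma block_sum: "(\<And>x. x \<in> S \<Longrightarrow> block m n (f x)) \<Longrightarrow> block m n (\<Sum>x\<in>S. f x)"
  by (induction S rule: infinite_finite_induct) (auto intro: block_add)

lemma mats_corner_iff:
  "A \<in> mats (corner k) m n \<longleftrightarrow> A \<in> carrier_mat m n \<and> (\<forall>i<m. \<forall>j<n. block k k (A $$ (i, j)))"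
  by (simp add: mats_iff corner_eq)

lemma block_rect_T: "block m n (rect_T m n A)"
  unfolding rect_T_def
proof (intro block_sum)
  fix i j assume ij: "i \<in> {..<m}" "j \<in> {..<n}"
  have "Iunit m * munit i 0 = munit i 0" "munit 0 j * Iunit n = munit 0 j"
    using ij by (auto intro!: fin_mat_eqI simp: entry_mult_munit entry_munit_mult entry_Iunit)
  then show "block m n (munit i 0 \<rhd> A $$ (i, j) \<lhd> munit 0 j)"
    by (simp add: block_def act_collect)
qed

lemma coords_mats: "coords m n x \<in> mats (corner 1) m n"
proof -
  have "block 1 1 (munit 0 i \<rhd> x \<lhd> munit j 0)" for i j
    unfolding block_def Iunit_1 by (simp add: act_collect munit_mult_munit)
  then show ?thesis by (simp add: mats_corner_iff coords_def)
qed

lemma rect_T_coords: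
  assumes "block m n x"
  shows "rect_T m n (coords m n x) = x"
proof -
  have "rect_T m n (coords m n x) = (\<Sum>i<m. \<Sum>j<n. munit i i \<rhd> x \<lhd> munit j j)"
    by (simp add: rect_T_def coords_def act_collect munit_mult_munit)
  also have "\<dots> = Iunit m \<rhd> x \<lhd> Iunit n"
    by (simp add: Iunit_def sum_lact sum_ract ract_sum) (rule sum.swap)
  finally show ?thesis using assms by (simp add: block_def)
qed

lemma coords_rect_T:
  assumes "A \<in> mats (corner 1) m n"
  shows "coords m n (rect_T m n A) = A"
proof (rule eq_matI)
  fix k l assume kl: "k < dim_row A" "l < dim_col A"
  then have k: "k < m" "l < n" using assms by (auto simp: mats_iff)
  have "munit 0 k \<rhd> rect_T m n A \<lhd> munit l 0
      = (\<Sum>i<m. \<Sum>j<n. (munit 0 k * munit i 0) \<rhd> A $$ (i, j) \<lhd> (munit 0 j * munit l 0))"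
    by (simp add: rect_T_def lact_sum sum_ract act_collect)
  also have "\<dots> = (\<Sum>i<m. \<Sum>j<n. if j = l then if i = k
      then munit 0 0 \<rhd> A $$ (k, l) \<lhd> munit 0 0 else 0 else 0)"
    by (intro sum.cong refl) (simp add: munit_mult_munit)
  also have "\<dots> = munit 0 0 \<rhd> A $$ (k, l) \<lhd> munit 0 0"
    using k by (simp add: sum.delta)
  also have "\<dots> = A $$ (k, l)"
    using assms k by (simp add: mats_corner_iff block_def Iunit_1)
  finally show "coords m n (rect_T m n A) $$ (k, l) = A $$ (k, l)"
    using k by (simp add: coords_def)
qed (use assms in \<open>auto simp: coords_def mats_iff\<close>)

lemma rect_T_inject:
  "A \<in> mats (corner 1) m n \<Longrightarrow> B \<in> mats (corner 1) m n \<Longrightarrow> rect_T m n A = rect_T m n B \<Longrightarrow> A = B"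
  by (metis coords_rect_T)

lemma bij_betw_T: "bij_betw (T n) (mats (corner 1) n n) (corner n)"
  unfolding T_eq_rect_T
  by (rule bij_betwI[where g = "coords n n"])
     (auto simp: corner_eq[of n] block_rect_T coords_mats rect_T_coords coords_rect_T)

lemma T_inv_eq: "block n n x \<Longrightarrow> T_inv n x = coords n n x"
  unfolding T_inv_def
  using bij_betw_T[of n] by (intro inv_into_f_eq)
    (auto simp: bij_betw_def coords_mats rect_T_coords T_eq_rect_T)

lemma rect_T_add:
  "A \<in> carrier_mat m n \<Longrightarrow> B \<in> carrier_mat m n \<Longrightarrow> rect_T m n (A + B) = rect_T m n A + rect_T m n B"
  by (simp add: rect_T_def lact_add add_ract sum.distrib)

lemma rect_T_diff:
  "A \<in> carrier_mat m n \<Longrightarrow> B \<in> carrier_mat m n \<Longrightarrow> rect_T m n (A - B) = rect_T m n A - rect_T m n B"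
  by (simp add: rect_T_def lact_diff diff_ract sum_subtractf)

lemma rect_T_zero [simp]: "rect_T m n (0\<^sub>m m n) = 0"
  by (simp add: rect_T_def)

text \<open>Reindexing the lower right block amounts to multiplying by two shifts, so direct sums of
  matrices become sums in the bimodule, where additivity on independent elements can be
  used.\<close>

lemma rect_T_dsum:
  assumes "v \<in> carrier_mat m n" "w \<in> carrier_mat r s"
  shows "rect_T (m + r) (n + s) (dsum v w)
    = rect_T m n v + (pinj {..<r} (\<lambda>i. m + i) \<rhd> rect_T r s w \<lhd> fin_adj (pinj {..<s} (\<lambda>j. n + j)))"
proof -
  have adj: "munit 0 j * fin_adj (pinj {..<s} (\<lambda>j. n + j)) = munit 0 (n + j)" if "j < s" for j
    using arg_cong[OF pinj_mult_munit[of "{..<s}" j "\<lambda>j. n + j" 0], of fin_adj] that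
    by (simp add: fin_adj_mult)
  have "rect_T (m + r) (n + s) (dsum v w)
      = rect_T m n v + (\<Sum>i<r. \<Sum>j<s. munit (m + i) 0 \<rhd> w $$ (i, j) \<lhd> munit 0 (n + j))"
    using assms by (simp add: rect_T_def sum_lessThan_add index_dsum)
  also have "(\<Sum>i<r. \<Sum>j<s. munit (m + i) 0 \<rhd> w $$ (i, j) \<lhd> munit 0 (n + j))
      = pinj {..<r} (\<lambda>i. m + i) \<rhd> rect_T r s w \<lhd> fin_adj (pinj {..<s} (\<lambda>j. n + j))"
    by (simp add: rect_T_def lact_sum sum_ract act_collect pinj_mult_munit adj)
  finally show ?thesis .
qed

end

context nondegenerate_F_bimodule
begin

lemma rect_T_cscale:
  "A \<in> carrier_mat m n \<Longrightarrow> rect_T m n (map_mat (cscale \<alpha>) A) = cscale \<alpha> (rect_T m n A)"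
  by (simp add: rect_T_def cscale_sum_right cscale_lact[symmetric] cscale_ract[symmetric] lact_cscale)

lemma rect_T_lmul:
  assumes "\<alpha> \<in> carrier_mat r m" "A \<in> carrier_mat m n"
  shows "rect_T r n (lmul cscale \<alpha> A) = fin_of_mat \<alpha> \<rhd> rect_T m n A"
proof -
  have "rect_T r n (lmul cscale \<alpha> A) = (\<Sum>i<r. \<Sum>k<n. \<Sum>j<m.
      fin_scale (\<alpha> $$ (i, j)) (munit i 0) \<rhd> A $$ (j, k) \<lhd> munit 0 k)"
    using assms by (simp add: rect_T_def lmul_def lact_sum sum_ract lact_cscale)
  \<comment> \<open>The row index i goes innermost, so that its sum can be gathered into
    \<open>fin_of_mat \<alpha> * munit j 0\<close>.\<close>
  also have "\<dots> = (\<Sum>j<m. \<Sum>k<n. \<Sum>i<r.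
      fin_scale (\<alpha> $$ (i, j)) (munit i 0) \<rhd> A $$ (j, k) \<lhd> munit 0 k)"
    by (subst (2) sum.swap, subst sum.swap, subst (2) sum.swap) simp
  also have "\<dots> = fin_of_mat \<alpha> \<rhd> rect_T m n A"
    by (simp add: rect_T_def lact_sum act_collect fin_of_mat_mult_munit[OF assms(1)] sum_lact sum_ract)
  finally show ?thesis .
qed

lemma rect_T_rmul:
  assumes "\<beta> \<in> carrier_mat n s" "A \<in> carrier_mat m n"
  shows "rect_T m s (rmul cscale A \<beta>) = rect_T m n A \<lhd> fin_of_mat \<beta>"
proof -
  have "rect_T m s (rmul cscale A \<beta>) = (\<Sum>i<m. \<Sum>k<s. \<Sum>j<n.
      munit i 0 \<rhd> A $$ (i, j) \<lhd> fin_scale (\<beta> $$ (j, k)) (munit 0 k))"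
    using assms
    by (simp add: rect_T_def rmul_def lact_sum sum_ract lact_cscale ract_scale cscale_lact)
  also have "\<dots> = (\<Sum>i<m. \<Sum>j<n. \<Sum>k<s.
      munit i 0 \<rhd> A $$ (i, j) \<lhd> fin_scale (\<beta> $$ (j, k)) (munit 0 k))"
    by (subst (2) sum.swap) simp
  also have "\<dots> = rect_T m n A \<lhd> fin_of_mat \<beta>"
    by (simp add: rect_T_def sum_ract ract_mult[symmetric] munit_mult_fin_of_mat[OF assms(1)] ract_sum)
  finally show ?thesis .
qed

lemma cscale_mats: "A \<in> mats (corner 1) m n \<Longrightarrow> map_mat (cscale \<alpha>) A \<in> mats (corner 1) m n"
  by (auto simp: mats_corner_iff block_cscale)

lemma add_mats: "A \<in> mats (corner 1) m n \<Longrightarrow> B \<in> mats (corner 1) m n \<Longrightarrow> A + B \<in> mats (corner 1) m n"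
  by (auto simp: mats_corner_iff block_add)

lemma diff_mats: "A \<in> mats (corner 1) m n \<Longrightarrow> B \<in> mats (corner 1) m n \<Longrightarrow> A - B \<in> mats (corner 1) m n"
  by (auto simp: mats_corner_iff block_diff)

lemma zero_mats: "0\<^sub>m m n \<in> mats (corner 1) m n"
  by (auto simp: mats_corner_iff)

lemma lmul_mats:
  "\<alpha> \<in> carrier_mat r m \<Longrightarrow> A \<in> mats (corner 1) m n \<Longrightarrow> lmul cscale \<alpha> A \<in> mats (corner 1) r n"
  by (auto simp: mats_corner_iff lmul_def intro!: block_sum block_cscale)

lemma rmul_mats:
  "\<beta> \<in> carrier_mat n s \<Longrightarrow> A \<in> mats (corner 1) m n \<Longrightarrow> rmul cscale A \<beta> \<in> mats (corner 1) m s"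
  by (auto simp: mats_corner_iff rmul_def intro!: block_sum block_cscale)

lemma dsum_mats:
  "v \<in> mats (corner 1) m n \<Longrightarrow> w \<in> mats (corner 1) r s \<Longrightarrow> dsum v w \<in> mats (corner 1) (m + r) (n + s)"
  by (auto simp: mats_corner_iff index_dsum intro: dsum_carrier)

end

context star_F_bimodule
begin

lemma rect_T_adj:
  assumes "A \<in> carrier_mat m n"
  shows "rect_T n m (adj_mat star A) = star (rect_T m n A)"
proof -
  have "star (rect_T m n A) = (\<Sum>i<m. \<Sum>j<n. munit j 0 \<rhd> star (A $$ (i, j)) \<lhd> munit 0 i)"
    by (simp add: rect_T_def star_sum star_act)
  also have "\<dots> = rect_T n m (adj_mat star A)"
    using assms by (subst sum.swap) (simp add: rect_T_def adj_mat_def)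
  finally show ?thesis by simp
qed

lemma adj_mats: "A \<in> mats (corner 1) m n \<Longrightarrow> adj_mat star A \<in> mats (corner 1) n m"
  by (auto simp: mats_corner_iff adj_mat_def block_star)

lemma sa_mats_iff:
  "A \<in> sa_mats (corner 1) star n \<longleftrightarrow> A \<in> mats (corner 1) n n \<and> star (rect_T n n A) = rect_T n n A"
proof (cases "A \<in> mats (corner 1) n n")
  case True
  then have "rect_T n n (adj_mat star A) = star (rect_T n n A)" by (intro rect_T_adj) (simp add: mats_iff)
  with True show ?thesis
    using rect_T_inject[OF adj_mats[OF True] True] by (auto simp: sa_mats_def)
qed (simp add: sa_mats_def)

end

section \<open>Cones and absolute values of matrices over the corner\<close>

context nondegenerate_absolutely_ordered_F_bimodule
begin

text \<open>Compression by \<open>Iunit n\<close> fixes \<open>rect_T n n A\<close> and maps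
  \<open>P\<close> into itself, so the image of \<open>P\<close> in the definition of the cone may
  be replaced by \<open>P\<close>.\<close>

lemma mat_cone_iff: "A \<in> mat_cone P n \<longleftrightarrow> A \<in> mats (corner 1) n n \<and> rect_T n n A \<in> P"
proof -
  have "rect_T n n A \<in> (\<lambda>p. Iunit n \<rhd> p \<lhd> Iunit n) ` P \<longleftrightarrow> rect_T n n A \<in> P"
  proof
    assume "rect_T n n A \<in> P"
    then show "rect_T n n A \<in> (\<lambda>p. Iunit n \<rhd> p \<lhd> Iunit n) ` P"
      using block_rect_T[of n n A] by (auto simp: block_def intro!: rev_image_eqI)
  qed (use P_conj[of _ "Iunit n"] in auto)
  then show ?thesis by (simp add: mat_cone_def T_eq_rect_T)
qed

lemma mat_cone_sa: "A \<in> mat_cone P n \<Longrightarrow> A \<in> sa_mats (corner 1) star n"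
  by (simp add: mat_cone_iff sa_mats_iff P_sa)

text \<open>One formula for all shapes, with no padding to squares: all blocks lie in the same
  bimodule, and only the column number \<open>n\<close> determines the corner of the value.\<close>

definition rect_abs :: "nat \<Rightarrow> nat \<Rightarrow> 'a mat \<Rightarrow> 'a mat" where
  "rect_abs m n A = coords n n (absv (rect_T m n A))"

lemma rect_T_rect_abs: "rect_T n n (rect_abs m n A) = absv (rect_T m n A)"
  unfolding rect_abs_def by (rule rect_T_coords[OF block_absv_cols[OF block_rect_T]])

lemma rect_abs_mats: "rect_abs m n A \<in> mats (corner 1) n n"
  unfolding rect_abs_def by (rule coords_mats)

lemma mat_abs_eq: "mat_abs absv n A = rect_abs n n A"
  unfolding mat_abs_def rect_abs_def T_eq_rect_T by (rule T_inv_eq[OF block_absv_cols[OF block_rect_T]])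

lemma real_ordered_space_sa_mats:
  "real_ordered_space (sa_mats (corner 1) star n) (+) (0\<^sub>m n n)
     (\<lambda>r. map_mat (cscale (of_real r))) (mat_cone P n)"
proof (intro real_ordered_space.intro vector_space_on.intro real_ordered_space_axioms.intro)
  let ?S = "sa_mats (corner 1) star n" and ?scl = "\<lambda>r. map_mat (cscale (of_real r))"
  have car: "A \<in> ?S \<Longrightarrow> A \<in> carrier_mat n n" for A by (simp add: sa_mats_iff mats_iff)
  fix u v w :: "'a mat" and k l :: real
  show "u + v \<in> ?S" if "u \<in> ?S" "v \<in> ?S"
    using that car[of u] car[of v] by (simp add: sa_mats_iff add_mats rect_T_add star_add)
  show "0\<^sub>m n n \<in> ?S" by (simp add: sa_mats_iff zero_mats)
  show "?scl k v \<in> ?S" if "v \<in> ?S"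
    using that car[of v] by (simp add: sa_mats_iff cscale_mats rect_T_cscale star_cscale)
  show "u + v + w = u + (v + w)" if "u \<in> ?S" "v \<in> ?S" "w \<in> ?S"
    using that car by (simp add: assoc_add_mat[of _ n n])
  show "u + v = v + u" if "u \<in> ?S" "v \<in> ?S"
    using that car by (simp add: comm_add_mat[of _ n n])
  show "v + 0\<^sub>m n n = v" if "v \<in> ?S"
    using that car by simp
  show "v + ?scl (- 1) v = 0\<^sub>m n n" if "v \<in> ?S"
    using car[OF that] by (intro eq_matI) auto
  show "?scl k (u + v) = ?scl k u + ?scl k v" if "u \<in> ?S" "v \<in> ?S"
    using car[OF that(1)] car[OF that(2)] by (intro eq_matI) (auto simp: cscale_add_right)
  show "?scl (k + l) v = ?scl k v + ?scl l v" if "v \<in> ?S"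
    using car[OF that] by (intro eq_matI) (auto simp: cscale_add_left)
  show "?scl k (?scl l v) = ?scl (k * l) v" if "v \<in> ?S"
    using car[OF that] by (intro eq_matI) (auto simp: cscale_cscale)
  show "?scl 1 v = v" if "v \<in> ?S"
    using car[OF that] by (intro eq_matI) auto
next
  let ?scl = "\<lambda>r. map_mat (cscale (of_real r))"
  have car: "A \<in> mat_cone P n \<Longrightarrow> A \<in> carrier_mat n n" for A by (simp add: mat_cone_iff mats_iff)
  show "mat_cone P n \<subseteq> sa_mats (corner 1) star n" using mat_cone_sa by blast
  show "0\<^sub>m n n \<in> mat_cone P n" by (simp add: mat_cone_iff zero_mats P_zero)
  fix u v :: "'a mat" and k :: real
  show "u + v \<in> mat_cone P n" if "u \<in> mat_cone P n" "v \<in> mat_cone P n"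
    using that car[of u] car[of v] by (simp add: mat_cone_iff add_mats rect_T_add P_add)
  show "?scl k v \<in> mat_cone P n" if "v \<in> mat_cone P n" "0 \<le> k"
    using that car[of v] by (simp add: mat_cone_iff cscale_mats rect_T_cscale P_scale)
  show "v = 0\<^sub>m n n" if "v \<in> mat_cone P n" "?scl (- 1) v \<in> mat_cone P n"
  proof (rule rect_T_inject)
    show "rect_T n n v = rect_T n n (0\<^sub>m n n)"
      using that car[of v] P_proper[of "rect_T n n v"] by (simp add: mat_cone_iff rect_T_cscale)
  qed (use that in \<open>auto simp: mat_cone_iff zero_mats\<close>)
qed

text \<open>Orthogonality \<open>|u - v| = u + v\<close> of self-adjoint \<open>u\<close>, \<open>v\<close> forces both to be positive, since
  \<open>|x| \<plusminus> x \<ge> 0\<close> for \<open>x = u - v\<close>.\<close>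

lemma orthogonal_imp_P:
  assumes "star u = u" "star v = v" "absv (u - v) = u + v"
  shows "u \<in> P" "v \<in> P"
proof -
  have half: "x + x \<in> P \<Longrightarrow> x \<in> P" for x
    using P_scale[of "x + x" "1/2"] half_double[of x] by simp
  show "u \<in> P" "v \<in> P"
    using absv_star_bound[of "u - v"] assms half[of u] half[of v]
    by (simp_all add: star_diff algebra_simps)
qed

lemma absolutely_ordered_space_sa_mats:
  "absolutely_ordered_space (sa_mats (corner 1) star n) (+) (0\<^sub>m n n)
     (\<lambda>r. map_mat (cscale (of_real r))) (mat_cone P n) (rect_abs n n)"
proof (intro absolutely_ordered_space.intro real_ordered_space_sa_mats
    absolutely_ordered_space_axioms.intro)
  interpret real_ordered_space "sa_mats (corner 1) star n" "(+)" "0\<^sub>m n n"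
    "\<lambda>r. map_mat (cscale (of_real r))" "mat_cone P n"
    by (rule real_ordered_space_sa_mats)
  let ?S = "sa_mats (corner 1) star n" and ?scl = "\<lambda>r. map_mat (cscale (of_real r))"
  let ?t = "rect_T n n"
  have car: "A \<in> ?S \<Longrightarrow> A \<in> carrier_mat n n" for A by (simp add: sa_mats_iff mats_iff)
  have mats: "A \<in> ?S \<Longrightarrow> A \<in> mats (corner 1) n n" for A by (simp add: sa_mats_iff)
  have rcar: "rect_abs n n A \<in> carrier_mat n n" for A using rect_abs_mats by (simp add: mats_iff)
  have rect_absS: "rect_abs n n A \<in> ?S" for A
    by (simp add: sa_mats_iff rect_abs_mats rect_T_rect_abs P_sa absv_P)
  have t_add: "?t (A + B) = ?t A + ?t B" if "A \<in> ?S" "B \<in> ?S" for A B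
    using that car by (simp add: rect_T_add)
  have t_diff: "?t (diff A B) = ?t A - ?t B" if "A \<in> ?S" "B \<in> ?S" for A B
    using that car by (simp add: diff_def rect_T_add rect_T_cscale)
  have diffS: "diff A B \<in> ?S" if "A \<in> ?S" "B \<in> ?S" for A B
    using that unfolding diff_def by (intro add_closed scl_closed)
  \<comment> \<open>Injectivity of \<open>rect_T\<close> moves each equation between matrices into
    the bimodule, where the axioms are stated.\<close>
  have abs_eq_iff: "rect_abs n n A = B \<longleftrightarrow> absv (?t A) = ?t B" if "B \<in> ?S" for A B
    using rect_T_inject[OF rect_abs_mats mats[OF that], of n A] by (auto simp: rect_T_rect_abs)
  have posS: "A \<in> mat_cone P n \<Longrightarrow> A \<in> ?S" for A by (rule mat_cone_sa)
  have pos_iff: "A \<in> mat_cone P n \<longleftrightarrow> ?t A \<in> P" if "A \<in> ?S" for A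
    using mats[OF that] by (simp add: mat_cone_iff)
  have star_t: "A \<in> ?S \<Longrightarrow> star (?t A) = ?t A" for A by (simp add: sa_mats_iff)
  fix u v w :: "'a mat" and k :: real
  show "rect_abs n n v \<in> mat_cone P n"
    by (simp add: mat_cone_iff rect_abs_mats rect_T_rect_abs absv_P)
  show "rect_abs n n v = v" if "v \<in> mat_cone P n"
    using that by (simp add: abs_eq_iff posS absv_pos mat_cone_iff)
  show "rect_abs n n v + v \<in> mat_cone P n" if "v \<in> ?S"
    using that absv_star_bound(1)[OF star_t] by (simp add: pos_iff add_closed rect_absS t_add rect_T_rect_abs)
  show "diff (rect_abs n n v) v \<in> mat_cone P n" if "v \<in> ?S"
    using that absv_star_bound(2)[OF star_t] by (simp add: pos_iff diffS rect_absS t_diff rect_T_rect_abs)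
  show "rect_abs n n (?scl k v) = ?scl \<bar>k\<bar> (rect_abs n n v)" if "v \<in> ?S"
    using that car[of v] rcar
    by (subst abs_eq_iff) (simp_all add: scl_closed rect_absS rect_T_cscale rect_T_rect_abs absv_cscale)
  show "rect_abs n n (diff u w) = u + w"
    if "u \<in> ?S" "v \<in> ?S" "w \<in> ?S" "rect_abs n n (diff u v) = u + v" "w \<in> mat_cone P n"
      "diff v w \<in> mat_cone P n"
  proof -
    have eq: "absv (?t u - ?t v) = ?t u + ?t v"
      using that by (simp add: abs_eq_iff add_closed t_add t_diff)
    \<comment> \<open>The bimodule axiom asks for positive \<open>u\<close> and \<open>v\<close>,
      the matrix axiom only for self-adjoint ones; orthogonality closes the gap.\<close>
    note pos = orthogonal_imp_P[OF star_t star_t eq, OF that(1,2)]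
    have "absv (?t u - ?t w) = ?t u + ?t w"
      by (rule absv_hered[OF pos _ eq]) (use that in \<open>simp_all add: pos_iff diffS t_diff le_def\<close>)
    then show ?thesis using that by (simp add: abs_eq_iff add_closed t_add t_diff)
  qed
  have orth: "absv (?t u - ?t x) = ?t u + ?t x" "?t u \<in> P" "?t x \<in> P"
    if "u \<in> ?S" "x \<in> ?S" "rect_abs n n (diff u x) = u + x" for x
  proof -
    show eq: "absv (?t u - ?t x) = ?t u + ?t x"
      using that by (simp add: abs_eq_iff add_closed t_add t_diff)
    show "?t u \<in> P" "?t x \<in> P" using orthogonal_imp_P[OF star_t star_t eq] that by auto
  qed
  show "rect_abs n n (diff u (rect_abs n n (v + w))) = u + rect_abs n n (v + w)"
    if S: "u \<in> ?S" "v \<in> ?S" "w \<in> ?S" and o: "rect_abs n n (diff u v) = u + v" "rect_abs n n (diff u w) = u + w"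
    using absv_plus[of "?t u" "?t v" "?t w"] orth[OF S(1,2) o(1)] orth[OF S(1,3) o(2)] S
    by (simp add: abs_eq_iff add_closed rect_absS t_add t_diff rect_T_rect_abs)
  show "rect_abs n n (diff u (rect_abs n n (diff v w))) = u + rect_abs n n (diff v w)"
    if S: "u \<in> ?S" "v \<in> ?S" "w \<in> ?S" and o: "rect_abs n n (diff u v) = u + v" "rect_abs n n (diff u w) = u + w"
    using absv_minus[of "?t u" "?t v" "?t w"] orth[OF S(1,2) o(1)] orth[OF S(1,3) o(2)] S
    by (simp add: abs_eq_iff add_closed rect_absS t_add t_diff rect_T_rect_abs)
qed

lemma matrix_ordered_space_corner: "matrix_ordered_space (corner 1) cscale star (mat_cone P)"
proof (intro matrix_ordered_space.intro vector_space_on.intro matrix_ordered_space_axioms.intro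
    real_ordered_space_sa_mats)
  fix m n A and \<alpha> :: "complex mat"
  assume A: "A \<in> mat_cone P n" and \<alpha>: "\<alpha> \<in> carrier_mat n m"
  have \<alpha>': "adj_mat cnj \<alpha> \<in> carrier_mat m n" using \<alpha> by (auto simp: adj_mat_def)
  have A': "A \<in> mats (corner 1) n n" using A by (simp add: mat_cone_iff)
  have l: "lmul cscale (adj_mat cnj \<alpha>) A \<in> mats (corner 1) m n" by (rule lmul_mats[OF \<alpha>' A'])
  have "rect_T m m (rmul cscale (lmul cscale (adj_mat cnj \<alpha>) A) \<alpha>)
      = fin_adj (fin_of_mat \<alpha>) \<rhd> rect_T n n A \<lhd> fin_of_mat \<alpha>"
    using \<alpha> \<alpha>' A' l by (simp add: rect_T_rmul[of _ n] rect_T_lmul[of _ _ n] mats_iff fin_adj_fin_of_mat)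
  then show "rmul cscale (lmul cscale (adj_mat cnj \<alpha>) A) \<alpha> \<in> mat_cone P m"
    using A rmul_mats[OF \<alpha> l] by (simp add: mat_cone_iff P_conj)
qed (auto simp: corner_eq block_add block_cscale block_star cscale_add_right cscale_add_left
    cscale_cscale star_add star_cscale star_star algebra_simps)

text \<open>The two summands share indices in general when the blocks are not square, since rows and
  columns are indexed by the same set. Moving all rows beyond the columns by a partial isometry,
  which does not change absolute values, makes them \<open>F_independent\<close>.\<close>

lemma absv_block_sum:
  assumes x: "block m n x" and y: "block r s y"
  defines "Sm \<equiv> pinj {..<r} (\<lambda>i. m + i)" and "Sn \<equiv> pinj {..<s} (\<lambda>j. n + j)"
  shows "absv (x + (Sm \<rhd> y \<lhd> fin_adj Sn)) = absv x + (Sn \<rhd> absv y \<lhd> fin_adj Sn)"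
proof -
  let ?U = "pinj {..<m + r} (\<lambda>i. n + s + i)" and ?y = "Sm \<rhd> y \<lhd> fin_adj Sn"
  \<comment> \<open>After the shift by \<open>n + s\<close>, \<open>?I\<close> consists of the
    columns and the new rows of \<open>x\<close>, and \<open>?J\<close> of those of
    \<open>?y\<close>: four disjoint intervals.\<close>
  let ?I = "{..<n} \<union> {n + s..<n + s + m}" and ?J = "{n..<n + s} \<union> {n + s + m..<n + s + m + r}"
  have norms: "fin_norm (pinj {..<k} (\<lambda>i. l + i)) \<le> 1"
    "fin_norm (fin_adj (pinj {..<k} (\<lambda>i. l + i))) \<le> 1" for k l :: nat
    by (simp_all add: fin_norm_pinj fin_norm_adj_pinj)
  have UU: "fin_adj ?U * ?U = Iunit (m + r)" and SS: "fin_adj Sm * Sm = Iunit r"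
    by (simp_all add: adj_pinj_mult_pinj Iunit_eq_dproj Sm_def)
  have xU: "Iunit (m + r) \<rhd> x = x"
    using block_lact[OF block_mono[OF x, of "m + r" n]] by simp
  have "Iunit (m + r) * Sm = Sm"
    unfolding Sm_def Iunit_eq_dproj by (rule dproj_mult_pinj) auto
  then have yU: "Iunit (m + r) \<rhd> ?y = ?y" by (simp add: act_collect)
  have U_abs: "absv (?U \<rhd> z) = absv z" if "Iunit (m + r) \<rhd> z = z" for z
    using that by (intro absv_partial_isometry_left norms) (simp add: UU)
  have UI: "?U * Iunit m = pinj {..<m} (\<lambda>i. n + s + i)"
    using pinj_mult_pinj[of "{..<m + r}" "{..<m}" "\<lambda>i. i" "\<lambda>i. n + s + i"]
    by (simp add: Iunit_def pinj_def)
  have UIm: "dproj ?I * (?U * Iunit m) = ?U * Iunit m"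
    unfolding UI by (rule dproj_mult_pinj) auto
  have InI: "Iunit n * dproj ?I = Iunit n"
    unfolding Iunit_eq_dproj by (subst dproj_mult_dproj) (auto simp: Int_absorb2)
  have USm: "?U * Sm = pinj {..<r} (\<lambda>i. n + s + (m + i))"
    unfolding Sm_def by (rule pinj_mult_pinj) auto
  have UJ: "dproj ?J * (?U * Sm) = ?U * Sm"
    unfolding USm by (rule dproj_mult_pinj) auto
  have "dproj ?J * Sn = Sn"
    unfolding Sn_def by (rule dproj_mult_pinj) auto
  from arg_cong[OF this, of fin_adj] have SnJ: "fin_adj Sn * dproj ?J = fin_adj Sn"
    by (simp add: fin_adj_mult fin_adj_dproj)
  have Ux: "?U \<rhd> x = (?U * Iunit m) \<rhd> x \<lhd> Iunit n"
    using x by (simp add: block_def mult_lact lact_ract[symmetric])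
  have Uy: "?U \<rhd> ?y = (?U * Sm) \<rhd> y \<lhd> fin_adj Sn"
    by (simp add: mult_lact lact_ract)
  have indep: "F_independent (?U \<rhd> x) (?U \<rhd> ?y)"
    unfolding F_independent_def
  proof (intro exI conjI)
    show "?I \<inter> ?J = {}" by auto
    show "dproj ?I \<rhd> (?U \<rhd> x) \<lhd> dproj ?I = ?U \<rhd> x"
      unfolding Ux by (simp only: act_collect UIm InI)
    show "dproj ?J \<rhd> (?U \<rhd> ?y) \<lhd> dproj ?J = ?U \<rhd> ?y"
      unfolding Uy by (simp only: act_collect UJ SnJ)
  qed auto
  have "absv (x + ?y) = absv (?U \<rhd> (x + ?y))"
    by (rule U_abs[symmetric]) (simp add: lact_add xU yU)
  also have "\<dots> = absv x + absv ?y"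
    using absv_indep[OF indep] by (simp add: lact_add U_abs xU yU)
  \<comment> \<open>The row shift \<open>Sm\<close> drops out of the absolute value, while the
    column shift \<open>Sn\<close> conjugates it.\<close>
  also have "absv ?y = absv (Sm \<rhd> (y \<lhd> fin_adj Sn))" by (simp add: lact_ract)
  also have "\<dots> = absv (y \<lhd> fin_adj Sn)"
    unfolding Sm_def
    by (intro absv_partial_isometry_left norms)
       (simp add: SS[unfolded Sm_def] lact_ract block_lact[OF y])
  also have "\<dots> = Sn \<rhd> absv y \<lhd> fin_adj Sn"
    using absv_partial_isometry_right[of "{..<s}" "\<lambda>j. n + j" y] block_ract[OF y]
    by (simp add: Sn_def Iunit_eq_dproj)
  finally show ?thesis .
qed

lemma absolutely_matrix_ordered_space_corner:
  "absolutely_matrix_ordered_space (corner 1) cscale star (mat_cone P) rect_abs"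
proof (intro absolutely_matrix_ordered_space.intro matrix_ordered_space_corner
    absolutely_matrix_ordered_space_axioms.intro absolutely_ordered_space_sa_mats)
  fix m n r s :: nat and v w :: "'a mat" and \<alpha> \<beta> :: "complex mat"
  show "rect_abs m n v \<in> mat_cone P n"
    by (simp add: mat_cone_iff rect_abs_mats rect_T_rect_abs absv_P)
  show "rect_abs (m + r) (n + s) (dsum v w) = dsum (rect_abs m n v) (rect_abs r s w)"
    if v: "v \<in> mats (corner 1) m n" and w: "w \<in> mats (corner 1) r s"
  proof (rule rect_T_inject[OF rect_abs_mats dsum_mats[OF rect_abs_mats rect_abs_mats]])
    have car: "v \<in> carrier_mat m n" "w \<in> carrier_mat r s"
      "rect_abs m n v \<in> carrier_mat n n" "rect_abs r s w \<in> carrier_mat s s"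
      using v w rect_abs_mats by (simp_all add: mats_iff)
    show "rect_T (n + s) (n + s) (rect_abs (m + r) (n + s) (dsum v w))
        = rect_T (n + s) (n + s) (dsum (rect_abs m n v) (rect_abs r s w))"
      by (simp add: rect_T_rect_abs rect_T_dsum car absv_block_sum[OF block_rect_T block_rect_T])
  qed
  assume v: "v \<in> mats (corner 1) m n" and \<alpha>: "\<alpha> \<in> carrier_mat r m" and \<beta>: "\<beta> \<in> carrier_mat n s"
  let ?X = "map_mat (cscale (of_real (mat_norm \<alpha>))) (rect_abs n s (rmul cscale (rect_abs m n v) \<beta>))"
  let ?Y = "rect_abs r s (rmul cscale (lmul cscale \<alpha> v) \<beta>)"
  have X: "?X \<in> mats (corner 1) s s" by (intro cscale_mats rect_abs_mats)
  have Y: "?Y \<in> mats (corner 1) s s" by (rule rect_abs_mats)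
  have car: "v \<in> carrier_mat m n" "lmul cscale \<alpha> v \<in> carrier_mat r n" "rect_abs m n v \<in> carrier_mat n n"
    "rect_abs n s A \<in> carrier_mat s s" for A
    using v lmul_mats[OF \<alpha> v] rect_abs_mats by (simp_all add: mats_iff)
  have tX: "rect_T s s ?X = cscale (of_real (mat_norm \<alpha>)) (absv (absv (rect_T m n v) \<lhd> fin_of_mat \<beta>))"
    by (simp add: rect_T_cscale car rect_T_rect_abs rect_T_rmul[OF \<beta>])
  have tY: "rect_T s s ?Y = absv (fin_of_mat \<alpha> \<rhd> rect_T m n v \<lhd> fin_of_mat \<beta>)"
    by (simp add: rect_T_rect_abs rect_T_rmul[OF \<beta>] rect_T_lmul[OF \<alpha>] car)
  have "rect_T s s (?X - ?Y) = rect_T s s ?X - rect_T s s ?Y"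
    using X Y by (intro rect_T_diff) (simp_all add: mats_iff)
  \<comment> \<open>The contraction axiom speaks of \<open>fin_norm\<close> of the embedded matrix;
    its upper bound \<open>mat_norm \<alpha>\<close> may take its place.\<close>
  then show "?X - ?Y \<in> mat_cone P s"
    using absv_act_le[OF fin_norm_fin_of_mat[of \<alpha>], of "rect_T m n v" "fin_of_mat \<beta>"] diff_mats[OF X Y]
    by (simp add: mat_cone_iff tX tY le_def)
qed

lemma matricial_inductive_limit_corner:
  "matricial_inductive_limit star P absv (mat_cone P) (mat_abs absv)"
  unfolding matricial_inductive_limit_def
proof (intro conjI allI ballI impI)
  fix n :: nat and v w :: "'a mat" and \<alpha> \<beta> :: "complex mat" and c m
  show "bij_betw (T n) (mats (corner 1) n n) (corner n)" by (rule bij_betw_T)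
  assume v: "v \<in> mats (corner 1) n n"
  then have v': "v \<in> carrier_mat n n" by (simp add: mats_iff)
  show "T n (v + w) = T n v + T n w" if "w \<in> mats (corner 1) n n"
    using that v' unfolding T_eq_rect_T by (intro rect_T_add) (simp_all add: mats_iff)
  show "T n (map_mat (cscale c) v) = cscale c (T n v)"
    using v' by (simp add: T_eq_rect_T rect_T_cscale)
  show "T n (adj_mat star v) = star (T n v)"
    using v' by (simp add: T_eq_rect_T rect_T_adj)
  show "T n (rmul cscale (lmul cscale \<alpha> v) \<beta>) = fin_of_mat \<alpha> \<rhd> T n v \<lhd> fin_of_mat \<beta>"
    if "\<alpha> \<in> carrier_mat n n" "\<beta> \<in> carrier_mat n n"
    using that v' lmul_mats[OF that(1) v] by (simp add: T_eq_rect_T rect_T_rmul[of _ n] rect_T_lmul[of _ _ n] mats_iff)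
  show "T (n + m) (dsum v (0\<^sub>m m m)) = T n v"
    using v' by (simp add: T_eq_rect_T rect_T_dsum)
next
  have ex: "x = T (ord x) (coords (ord x) (ord x) x)" "coords (ord x) (ord x) x \<in> mats (corner 1) (ord x) (ord x)" for x
    by (simp_all add: T_eq_rect_T rect_T_coords block_ord coords_mats)
  show "UNIV = (\<Union>n\<in>{1..}. T n ` mats (corner 1) n n)"
    using ex ord_ge_1 by blast
  show "P = (\<Union>n\<in>{1..}. T n ` mat_cone P n)"
  proof (rule equalityI; rule subsetI)
    fix x assume "x \<in> P"
    then have "coords (ord x) (ord x) x \<in> mat_cone P (ord x)"
      using ex[of x] by (simp add: mat_cone_iff T_eq_rect_T)
    then show "x \<in> (\<Union>n\<in>{1..}. T n ` mat_cone P n)"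
      using ex(1)[of x] ord_ge_1[of x] by blast
  qed (auto simp: mat_cone_iff T_eq_rect_T)
  fix x
  show "absv x = T (ord x) (mat_abs absv (ord x) (T_inv (ord x) x))"
    by (simp add: mat_abs_eq T_eq_rect_T rect_T_rect_abs T_inv_eq block_ord rect_T_coords)
qed

end

theorem theorem3p13:
  fixes lact :: "fin_mat \<Rightarrow> 'v::ab_group_add \<Rightarrow> 'v"
    and ract :: "'v \<Rightarrow> fin_mat \<Rightarrow> 'v"
    and star :: "'v \<Rightarrow> 'v" and P :: "'v set" and absv :: "'v \<Rightarrow> 'v"
  assumes "nondegenerate_absolutely_ordered_F_bimodule lact ract star P absv"
  shows "absolutely_matrix_ordered_space_sq
           (F_actions.corner lact ract 1) (F_actions.cscale lact ract) star
           (F_actions.mat_cone lact ract P) (F_actions.mat_abs lact ract absv) \<and>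
         F_actions.matricial_inductive_limit lact ract star P absv
           (F_actions.mat_cone lact ract P) (F_actions.mat_abs lact ract absv)"
proof -
  interpret nondegenerate_absolutely_ordered_F_bimodule lact ract star P absv by fact
  show ?thesis
    \<comment> \<open>The witness for the rectangular absolute values is \<open>rect_abs\<close>,
      which agrees with \<open>mat_abs\<close> on square matrices.\<close>
    unfolding absolutely_matrix_ordered_space_sq_def
    using absolutely_matrix_ordered_space_corner matricial_inductive_limit_corner
    by (metis mat_abs_eq)
qed

end
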